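(* Let $x>0$. The following hold. (1) For any $r\in\mathbb{N}$, $r\ge2$, and any $t\in\mathbb{N}\cup\{0\}$, $s=1-t$ is a singular point of $\Theta(r,s,t,x)$, with the following polar singularity structure in $s$ (around $s=1-t$): $$\Theta(r,s,t,x)=\frac{x^{-t}\zeta(r)}{(s-(1-t))}+\Bigg(\gamma\zeta(r)x^{-t}+(-1)^r\sum_{j=0}^{t-2}\binom{j+r-1}{j}\frac{(-1)^{t-j}}{(t-j-1)!}\frac{1}{x^{j+r}}\sum_{m=1}^{\infty}\frac{\psi^{(t-j-1)}(mx+1)}{m^{r+j-t+1}}$$ $$\qquad+\sum_{i=1}^{r-2}\frac{(-1)^i}{x^{t+i}}\binom{i+t-1}{i}\zeta(i+1)\zeta(r-i)-\frac{(-1)^r}{x^{r+t-1}}\binom{r+t-2}{t-1}\sum_{m=1}^{\infty}\frac{\gamma+\psi(mx+1)}{m^r}\Bigg)+O(|s-(1-t)|).$$ (2) For $r=1$ and any $t\in\mathbb{N}$, $s=1-t$ is a singular point of $\Theta(1,s,t,x)$, with the following polar singularity structure in $s$ (around $s=1-t$): $$\Theta(1,s,t,x)=\frac{x^{-t}}{(s-(1-t))^2}+\frac{x^{-t}}{(s-(1-t))}\left(\gamma+\log(x)+H_{t-1}\right)+\Bigg(\frac{1}{x^t}\big(\gamma(\gamma+\log(x)+H_{t-1})+\gamma_1\big)$$ $$\qquad-\sum_{j=0}^{t-2}\frac{(-1)^{t-j}x^{-j-1}}{(t-j-1)!}\sum_{m=1}^{\infty}\frac{\psi^{(t-j-1)}(mx)+(-1)^{t-j}(t-j-2)!\,(mx)^{-(t-j-1)}}{m^{j-t+2}}$$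 $$\qquad+\frac{t\,\zeta(2)}{x^{t+1}}+\frac{1}{x^t}\sum_{m=1}^{\infty}\frac{\psi(mx)-\log(mx)}{m}\Bigg)+O(|s-(1-t)|).$$
   Context: $\mathbb{N}=\{1,2,3,\dots\}$. For $x>0$ and $(r,s,t)\in\mathbb{C}^3$ with $\Re(r+t)>1$, $\Re(s+t)>1$, $\Re(r+s+t)>2$, the generalized Mordell–Tornheim zeta function is the absolutely convergent series $\Theta(r,s,t,x)=\sum_{n=1}^{\infty}\sum_{m=1}^{\infty}\frac{1}{n^r m^s (n+mx)^t}$. For fixed $x>0$ it continues meromorphically to $(r,s,t)\in\mathbb{C}^3$, with possible singularities only on the hyperplanes $r+t=1-\ell$, $s+t=1-\ell$ ($\ell\in\mathbb{N}\cup\{0\}$) and $r+s+t=2$; $\Theta$ also denotes this continuation, considered here with $r,t,x$ fixed as a function of $s$. $\zeta$ is the Riemann zeta function, $\gamma$ is Euler's constant, $\gamma_1$ is the first Stieltjes constant, defined by $\zeta(1+z)=\frac1z+\gamma-\gamma_1 z+O(z^2)$ as $z\to0$; $\psi=\Gamma'/\Gamma$ is the digamma function and $\psi^{(k)}$ its $k$-th derivative; $H_n=\sum_{i=1}^n 1/i$ is the $n$-th harmonic number, with $H_0=0$. Empty sums are $0$. Binomial convention: $\binom{-1}{0}=1$, $\binom{c}{-1}=0$ for $c\in\mathbb{Z}\setminus\{-1\}$, with the exception $\binom{-1}{-1}=1$, and $\binom{a}{b}=0$ for integers $0\le a<b$.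
   Formalization: In part (2), for t ≥ 2, the printed inner series diverge and the residue is wrong; the formal version has (-1)^{t-j-1} in place of (-1)^{t-j} before (t-j-2)!(mx)^{-(t-j-1)}, and γ+log(x)-H_{t-1} in place of γ+log(x)+H_{t-1} in both places. *)

theory Defs
  imports "HOL-Complex_Analysis.Complex_Analysis" "HOL-Library.Landau_Symbols"
begin

text \<open>The value at the pole \<open>1\<close> is left unspecified.\<close>

definition zeta :: "complex \<Rightarrow> complex" where
  "zeta = (SOME F. F holomorphic_on (- {1}) \<and>
     (\<forall>s. Re s > 1 \<longrightarrow> F s = (\<Sum>\<^sub>\<infinity>n\<in>{1::nat..}. 1 / of_nat n powr s)))"

definition stieltjes1 :: complex where
  "stieltjes1 = (THE g. (\<lambda>z. zeta (1 + z) - (1 / z + euler_mascheroni - g * z)) \<in> O[at 0](\<lambda>z. z\<^sup>2))"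

text \<open>Binomial coefficients of integers \<open>a, b \<ge> -1\<close>, with the special values
  \<open>binom (-1) 0 = binom (-1) (-1) = 1\<close> and \<open>binom a (-1) = 0\<close> for \<open>a \<noteq> -1\<close>.\<close>

definition binom :: "int \<Rightarrow> int \<Rightarrow> nat" where
  "binom a b =
     (if b = -1 then (if a = -1 then 1 else 0)
      else if a = -1 then (if b = 0 then 1 else 0)
      else nat a choose nat b)"

text \<open>Holomorphy in three variables is complex Frechet differentiability at every point of an
  open set: the derivative is required to be complex linear, not just real linear.\<close>

definition holomorphic3_on :: "(complex \<times> complex \<times> complex \<Rightarrow> complex) \<Rightarrow>
    (complex \<times> complex \<times> complex) set \<Rightarrow> bool" where
  "holomorphic3_on f U \<longleftrightarrow> open U \<and>
     (\<forall>p\<in>U. \<exists>a b c. (f has_derivative (\<lambda>(u, v, w). a * u + b * v + c * w)) (at p))"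

text \<open>\<open>f\<close> is holomorphic on the open set \<open>D\<close> and meromorphic on the whole space: locally it is a
  quotient of holomorphic functions whose denominator does not vanish identically.
  Values of \<open>f\<close> outside \<open>D\<close> are irrelevant.\<close>

definition meromorphic3_off :: "(complex \<times> complex \<times> complex \<Rightarrow> complex) \<Rightarrow>
    (complex \<times> complex \<times> complex) set \<Rightarrow> bool" where
  "meromorphic3_off f D \<longleftrightarrow> holomorphic3_on f D \<and>
     (\<forall>p. \<exists>U g h. p \<in> U \<and> connected U \<and> holomorphic3_on g U \<and> holomorphic3_on h U \<and>
        (\<exists>q\<in>U. h q \<noteq> 0) \<and> (\<forall>q\<in>U \<inter> D. f q * h q = g q))"

definition MT_series :: "real \<Rightarrow> complex \<times> complex \<times> complex \<Rightarrow> complex" where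
  "MT_series x = (\<lambda>(r, s, t). \<Sum>\<^sub>\<infinity>n\<in>{1::nat..}. \<Sum>\<^sub>\<infinity>m\<in>{1::nat..}.
     1 / (of_nat n powr r * of_nat m powr s * (of_nat n + of_nat m * of_real x) powr t))"

definition MT_convergence_region :: "(complex \<times> complex \<times> complex) set" where
  "MT_convergence_region = {(r, s, t). Re (r + t) > 1 \<and> Re (s + t) > 1 \<and> Re (r + s + t) > 2}"

definition MT_singular_hyperplanes :: "(complex \<times> complex \<times> complex) set" where
  "MT_singular_hyperplanes = {(r, s, t).
     (\<exists>l::nat. r + t = 1 - of_nat l) \<or> (\<exists>l::nat. s + t = 1 - of_nat l) \<or> r + s + t = 2}"

text \<open>\<open>\<Theta> (r, s, t)\<close> is the meromorphic continuation of the generalized Mordell--Tornheim zeta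
  function with parameter \<open>x\<close>. The complement of the hyperplanes is connected, so \<open>\<Theta>\<close> is
  uniquely determined there.\<close>

definition is_MT_zeta :: "real \<Rightarrow> (complex \<times> complex \<times> complex \<Rightarrow> complex) \<Rightarrow> bool" where
  "is_MT_zeta x \<Theta> \<longleftrightarrow>
     meromorphic3_off \<Theta> (- MT_singular_hyperplanes) \<and>
     (\<forall>p\<in>MT_convergence_region. \<Theta> p = MT_series x p)"

text \<open>Terms of the infinite series in the constant coefficients, for \<open>r \<ge> 2\<close> and \<open>r = 1\<close>.

  Since \<open>\<psi>\<^sup>(\<^sup>k\<^sup>)(y) \<sim> (-1)\<^sup>k\<^sup>+\<^sup>1 (k-1)! / y\<^sup>k\<close> as \<open>y \<rightarrow> \<infinity>\<close> for \<open>k \<ge> 1\<close>, the second term of the numerator in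
  \<open>psi_term1 x t j\<close>, where \<open>k = t - j - 1\<close>, must carry the sign \<open>(-1)\<^sup>t\<^sup>-\<^sup>j\<^sup>-\<^sup>1\<close>; with the sign \<open>(-1)\<^sup>t\<^sup>-\<^sup>j\<close>
  (as in the printed source) the terms would be asymptotic to a nonzero multiple of \<open>1/m\<close> and
  the series would diverge.
  The sum over \<open>j\<close> of the removed leading terms is what contributes \<open>-H\<^sub>t\<^sub>-\<^sub>1\<close> (printed as
  \<open>+H\<^sub>t\<^sub>-\<^sub>1\<close>) to the residue and to the constant coefficient in the case \<open>r = 1\<close>.\<close>

definition psi_term :: "real \<Rightarrow> nat \<Rightarrow> nat \<Rightarrow> nat \<Rightarrow> nat \<Rightarrow> complex" where
  "psi_term x r t j m =
     Polygamma (t - j - 1) (of_nat m * of_real x + 1) / of_nat m powi (int r + int j - int t + 1)"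

definition psi_term1 :: "real \<Rightarrow> nat \<Rightarrow> nat \<Rightarrow> nat \<Rightarrow> complex" where
  "psi_term1 x t j m =
     (Polygamma (t - j - 1) (of_nat m * of_real x)
        + (-1) ^ (t - j - 1) * fact (t - j - 2) / (of_nat m * of_real x) ^ (t - j - 1))
     / of_nat m powi (int j - int t + 2)"

end

theory Submission
  imports Defs "HOL-Real_Asymp.Real_Asymp"
begin

text \<open>
  For natural \<open>r\<close>, \<open>t\<close> and large \<open>Re s\<close>, summing over \<open>n\<close> first turns \<open>\<Theta>(r,s,t,x)\<close> into the Dirichlet series
  \<open>\<Sum>\<^sub>m F(m) m\<^sup>-\<^sup>s\<close> with \<open>F(m) = \<Sum>\<^sub>n 1 / (n\<^sup>r (n + m x)\<^sup>t)\<close>. Partial fractions in \<open>n\<close> evaluate \<open>F(m)\<close> by zeta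
  values and polygamma functions at \<open>m x\<close>, and the asymptotics of the latter give
  \<open>F(m) = (A + B ln m) / m\<^sup>t + O(m\<^sup>-\<^sup>t\<^sup>-\<^sup>1\<^sup>/\<^sup>2)\<close>. The main term contributes \<open>A \<zeta>(s+t) - B \<zeta>'(s+t)\<close>, which has the
  stated poles at \<open>s = 1 - t\<close>; the remainder contributes a Dirichlet series that converges beyond
  \<open>Re s = 1 - t\<close>, so its value at \<open>s = 1 - t\<close> is the rest of the constant coefficient. By the identity
  theorem in \<open>s\<close> this expansion holds for every continuation \<open>\<Theta>\<close>.
\<close>

section \<open>Dirichlet series\<close>

text \<open>\<open>zeta\<close> is an unspecified choice among continuations, so its holomorphy and
  its Laurent expansion at 1 have to be proved by constructing a continuation;
  \<open>\<Theta>\<close>, by contrast, is given by hypothesis. All polar data sit in one entire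
  function \<open>E\<close> with \<zeta>(1+w) = 1/w + \<gamma> + E(w) and E(0) = 0. Differentiation
  gives -\<zeta>'(1+w) = 1/w^2 - E'(w), and E'(0) is minus the Stieltjes constant. Hence a logarithm
  in F(m) raises the order of the pole and brings in \<open>stieltjes1\<close>. The two cases differ
  in which terms of F(m) have order m^-t. For r \<ge> 2 this is \<zeta>(r)/(m x)^t alone, so B = 0.
  For r = 1 it is the digamma term together with all polygamma terms; their leading parts produce
  the logarithm and the harmonic number. The margin 1/2 in the remainder absorbs the factor ln m,
  which for r = 2 multiplies m^(-t-1).\<close>

lemma infsum_atLeast_1_eq_suminf:
  fixes f :: "nat \<Rightarrow> 'a::banach"
  assumes "summable (\<lambda>n. norm (f n))"
  shows "f summable_on {1..}" "infsum f {1..} = (\<Sum>n. f (Suc n))"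
proof -
  have *: "bij_betw Suc UNIV {1..}"
    by (rule bij_betwI[where g = "\<lambda>n. n - 1"]) auto
  have "summable (\<lambda>n. norm (f (Suc n)))"
    using assms by (subst summable_Suc_iff)
  from norm_summable_imp_has_sum[OF this summable_sums[OF summable_norm_cancel[OF this]]]
  have "((\<lambda>n. f (Suc n)) has_sum (\<Sum>n. f (Suc n))) UNIV" .
  then have "(f has_sum (\<Sum>n. f (Suc n))) {1..}"
    using has_sum_reindex_bij_betw[OF *, of f] by simp
  then show "f summable_on {1..}" "infsum f {1..} = (\<Sum>n. f (Suc n))"
    by (auto simp: summable_on_def infsumI)
qed

lemma summable_on_atLeast_1_sums:
  fixes f :: "nat \<Rightarrow> 'a::banach"
  assumes "f summable_on {1..}"
  shows "(\<lambda>n. f (Suc n)) sums infsum f {1..}"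
proof -
  have *: "bij_betw Suc UNIV {1..}"
    by (rule bij_betwI[where g = "\<lambda>n. n - 1"]) auto
  have "((\<lambda>n. f (Suc n)) has_sum infsum f {1..}) UNIV"
    using has_sum_reindex_bij_betw[OF *, of f] assms by simp
  then show ?thesis by (rule has_sum_imp_sums)
qed

lemma powr_minus_real_summable: "1 < e \<Longrightarrow> summable (\<lambda>n. C * real n powr - e)"
  by (intro summable_mult) (simp add: summable_real_powr_iff)

lemma bigo_powr_summable:
  fixes f :: "nat \<Rightarrow> complex"
  assumes "f \<in> O(\<lambda>n. of_real (real n powr - e))" "1 < e"
  shows "f summable_on {1..}"
proof -
  have "(\<lambda>n. norm (f n)) \<in> O(\<lambda>n. real n powr - e)"
    using assms(1) by (subst (asm) landau_o.big.norm_iff[symmetric]) simp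
  then have "summable (\<lambda>n. norm (f n))"
    by (rule summable_comparison_test_bigo[rotated])
       (use powr_minus_real_summable[OF assms(2), of 1] in simp)
  then show ?thesis by (rule infsum_atLeast_1_eq_suminf(1))
qed

text \<open>The Weierstrass test with a majorant that may depend on the point. Besides holomorphy it
  yields the derivative series, which later computes \<gamma> from the Landau terms and turns
  coefficients ln m into a derivative of \<zeta>.\<close>

lemma infsum_has_derivative_local:
  fixes f :: "nat \<Rightarrow> complex \<Rightarrow> complex"
  assumes S: "open S"
    and hol: "\<And>n. n \<ge> 1 \<Longrightarrow> f n holomorphic_on S"
    and bound: "\<And>z. z \<in> S \<Longrightarrow> \<exists>d C e. d > 0 \<and> e > 1 \<and>
       (\<forall>\<^sub>F n in sequentially. \<forall>y\<in>ball z d \<inter> S. norm (f n y) \<le> C * real n powr - e)"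
    and z: "z \<in> S"
  shows "(\<lambda>n. f n z) summable_on {1..}"
    and "(\<lambda>n. deriv (f (Suc n)) z) sums deriv (\<lambda>s. \<Sum>\<^sub>\<infinity>n\<in>{1..}. f n s) z"
    and "(\<lambda>s. \<Sum>\<^sub>\<infinity>n\<in>{1..}. f n s) holomorphic_on S"
proof -
  have summ: "summable (\<lambda>n. norm (f n y))" if "y \<in> S" for y
  proof -
    from bound[OF that] obtain d C e where d: "d > 0" "e > 1"
      and ev: "\<forall>\<^sub>F n in sequentially. \<forall>w\<in>ball y d \<inter> S. norm (f n w) \<le> C * real n powr - e"
      by blast
    have "\<forall>\<^sub>F n in sequentially. norm (norm (f n y)) \<le> C * real n powr - e"
      using ev by eventually_elim (use d that in auto)
    then show ?thesis
      by (rule summable_comparison_test_ev[OF _ powr_minus_real_summable[OF d(2)]])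
  qed
  then show "(\<lambda>n. f n z) summable_on {1..}"
    using infsum_atLeast_1_eq_suminf[of "\<lambda>n. f n z"] z by auto
  have eq: "(\<Sum>\<^sub>\<infinity>n\<in>{1..}. f n y) = (\<Sum>n. f (Suc n) y)" if "y \<in> S" for y
    using infsum_atLeast_1_eq_suminf[OF summ[OF that]] by simp
  have "\<exists>g g'. \<forall>x\<in>S. (\<lambda>n. f (Suc n) x) sums g x \<and> (\<lambda>n. deriv (f (Suc n)) x) sums g' x \<and>
          (g has_field_derivative g' x) (at x)"
  proof (rule series_and_derivative_comparison_local[OF S])
    show "(f (Suc n) has_field_derivative deriv (f (Suc n)) x) (at x)" if "x \<in> S" for n x
      by (rule holomorphic_derivI[OF hol S that]) auto
    show "\<exists>d h. 0 < d \<and> summable h \<and>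
        (\<forall>\<^sub>F n in sequentially. \<forall>y\<in>ball x d \<inter> S. norm (f (Suc n) y) \<le> h n)" if x: "x \<in> S" for x
    proof -
      from bound[OF x] obtain d C e where d: "d > 0" "e > 1"
        and ev: "\<forall>\<^sub>F n in sequentially. \<forall>y\<in>ball x d \<inter> S. norm (f n y) \<le> C * real n powr - e"
        by blast
      have "summable (\<lambda>n. C * real (Suc n) powr - e)"
        using powr_minus_real_summable[OF d(2), of C] by (subst summable_Suc_iff)
      moreover have "\<forall>\<^sub>F n in sequentially. \<forall>y\<in>ball x d \<inter> S. norm (f (Suc n) y) \<le> C * real (Suc n) powr - e"
        using ev by (subst eventually_sequentially_Suc)
      ultimately show ?thesis using d by (intro exI[of _ d] exI[of _ "\<lambda>n. C * real (Suc n) powr - e"]) auto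
    qed
  qed
  then obtain g g' where g: "\<And>x. x \<in> S \<Longrightarrow> (\<lambda>n. f (Suc n) x) sums g x"
    "\<And>x. x \<in> S \<Longrightarrow> (\<lambda>n. deriv (f (Suc n)) x) sums g' x"
    "\<And>x. x \<in> S \<Longrightarrow> (g has_field_derivative g' x) (at x)" by blast
  have der: "((\<lambda>s. \<Sum>\<^sub>\<infinity>n\<in>{1..}. f n s) has_field_derivative g' x) (at x)" if "x \<in> S" for x
    by (rule has_field_derivative_transform_within_open[OF g(3)[OF that] S that])
       (use g(1) eq in \<open>auto simp: sums_iff\<close>)
  show "(\<lambda>n. deriv (f (Suc n)) z) sums deriv (\<lambda>s. \<Sum>\<^sub>\<infinity>n\<in>{1..}. f n s) z"
    using g(2)[OF z] DERIV_imp_deriv[OF der[OF z]] by simp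
  show "(\<lambda>s. \<Sum>\<^sub>\<infinity>n\<in>{1..}. f n s) holomorphic_on S"
    using der S by (auto simp: holomorphic_on_open)
qed

lemma norm_of_nat_powr: "n \<ge> 1 \<Longrightarrow> norm (of_nat n powr s :: complex) = real n powr Re s"
  using norm_powr_real_powr[of "of_nat n" s] by simp

text \<open>Near z the terms are O(n^-(c + Re y)), so convergence to the right of 1 - c is locally
  uniform, and differentiation brings down -ln n.\<close>

lemma Dirichlet_series:
  fixes a :: "nat \<Rightarrow> complex"
  assumes a: "a \<in> O(\<lambda>n. of_real (real n powr - c))"
    and s: "Re s > 1 - c"
  shows "(\<lambda>n. a n * of_nat n powr - s) summable_on {1..}"
    and "(\<lambda>n. - ln (real (Suc n)) * (a (Suc n) * of_nat (Suc n) powr - s)) sums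
           deriv (\<lambda>s. \<Sum>\<^sub>\<infinity>n\<in>{1..}. a n * of_nat n powr - s) s"
    and "(\<lambda>s. \<Sum>\<^sub>\<infinity>n\<in>{1..}. a n * of_nat n powr - s) holomorphic_on {s. Re s > 1 - c}"
proof -
  define S where "S = {s. Re s > 1 - c}"
  have sS: "s \<in> S" using s by (simp add: S_def)
  obtain C where C: "\<forall>\<^sub>F n in sequentially. norm (a n) \<le> C * real n powr - c"
    using landau_o.bigE[OF a] by auto
  have S: "open S" unfolding S_def by (rule open_halfspace_Re_gt)
  have bd: "\<exists>d C e. d > 0 \<and> e > 1 \<and>
       (\<forall>\<^sub>F n in sequentially. \<forall>y\<in>ball z d \<inter> S. norm (a n * of_nat n powr - y) \<le> C * real n powr - e)"
    if "z \<in> S" for z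
  proof (intro exI conjI)
    \<comment> \<open>Half the distance from z to the line Re s = 1 - c: on the ball of this radius
      the exponent c + Re y stays at least 1 + d.\<close>
    define d where "d = (Re z + c - 1) / 2"
    show "d > 0" "1 + d > 1" using that by (auto simp: d_def S_def)
    show "\<forall>\<^sub>F n in sequentially. \<forall>y\<in>ball z d \<inter> S. norm (a n * of_nat n powr - y) \<le> C * real n powr - (1 + d)"
      using C eventually_ge_at_top[of 1]
    proof eventually_elim
      case (elim n)
      show ?case
      proof
        fix y assume "y \<in> ball z d \<inter> S"
        then have "norm (z - y) < d" by (simp add: dist_norm)
        then have "Re (z - y) < d" using complex_Re_le_cmod[of "z - y"] by linarith
        then have y: "1 + d \<le> c + Re y" by (simp add: d_def field_simps)
        have "norm (a n * of_nat n powr - y) \<le> C * real n powr - c * real n powr - Re y"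
          using elim by (simp add: norm_mult norm_of_nat_powr mult_right_mono)
        also have "\<dots> = C * real n powr - (c + Re y)"
          using elim by (simp add: powr_add[symmetric] mult.assoc)
        also have "\<dots> \<le> C * real n powr - (1 + d)"
        proof -
          have "0 \<le> C * real n powr - c" using elim order_trans norm_ge_zero by blast
          then have "C \<ge> 0" using elim by (simp add: zero_le_mult_iff)
          then show ?thesis using y elim by (intro mult_left_mono powr_mono) auto
        qed
        finally show "norm (a n * of_nat n powr - y) \<le> C * real n powr - (1 + d)" .
      qed
    qed
  qed
  have hol: "(\<lambda>y. a n * of_nat n powr - y) holomorphic_on S" if "n \<ge> 1" for n
    using that by (auto intro!: holomorphic_intros)
  show "(\<lambda>n. a n * of_nat n powr - s) summable_on {1..}"
    using S hol bd sS by (rule infsum_has_derivative_local(1))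
  show "(\<lambda>s. \<Sum>\<^sub>\<infinity>n\<in>{1..}. a n * of_nat n powr - s) holomorphic_on {s. Re s > 1 - c}"
    unfolding S_def[symmetric] using S hol bd sS by (rule infsum_has_derivative_local(3))
  have der: "deriv (\<lambda>y. a (Suc n) * of_nat (Suc n) powr - y) s
      = - ln (real (Suc n)) * (a (Suc n) * of_nat (Suc n) powr - s)" for n s
  proof (rule DERIV_imp_deriv)
    have "((\<lambda>y. a (Suc n) * exp (- y * of_real (ln (real (Suc n))))) has_field_derivative
            a (Suc n) * (exp (- s * of_real (ln (real (Suc n)))) * (- of_real (ln (real (Suc n)))))) (at s)"
      by (auto intro!: derivative_eq_intros simp del: of_nat_Suc)
    then show "((\<lambda>y. a (Suc n) * of_nat (Suc n) powr - y) has_field_derivative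
        - ln (real (Suc n)) * (a (Suc n) * of_nat (Suc n) powr - s)) (at s)"
      by (simp add: powr_def Ln_of_nat algebra_simps del: of_nat_Suc)
  qed
  show "(\<lambda>n. - ln (real (Suc n)) * (a (Suc n) * of_nat (Suc n) powr - s)) sums
           deriv (\<lambda>s. \<Sum>\<^sub>\<infinity>n\<in>{1..}. a n * of_nat n powr - s) s"
  proof -
    have "(\<lambda>n. deriv (\<lambda>y. a (Suc n) * of_nat (Suc n) powr - y) s) sums
           deriv (\<lambda>s. \<Sum>\<^sub>\<infinity>n\<in>{1..}. a n * of_nat n powr - s) s"
      using S hol bd sS by (rule infsum_has_derivative_local(2))
    then show ?thesis unfolding der .
  qed
qed

section \<open>Continuation of the zeta function\<close>

text \<open>
  The remainder of order \<open>K\<close> in the binomial expansion of \<open>(n+1)\<^sup>1\<^sup>-\<^sup>s - n\<^sup>1\<^sup>-\<^sup>s\<close> in powers of \<open>1/n\<close>. It is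
  \<open>O(n\<^sup>-\<^sup>s\<^sup>-\<^sup>K\<^sup>-\<^sup>1)\<close>, so summing the expansion over \<open>n\<close> expresses \<open>(s-1) \<zeta>(s)\<close> by \<open>(s+j-1) \<zeta>(s+j)\<close> for
  \<open>1 \<le> j \<le> K\<close> and a series that is holomorphic for \<open>Re s > -K\<close> (Landau's method).
\<close>

definition Landau_term :: "nat \<Rightarrow> nat \<Rightarrow> complex \<Rightarrow> complex" where
  "Landau_term K n s = of_nat (Suc n) powr (1 - s) - of_nat n powr (1 - s) -
     (\<Sum>j\<le>K. (\<Prod>k\<le>j. 1 - s - of_nat k) / fact (Suc j) * of_nat n powr (- s - of_nat j))"

text \<open>Up to the factor n^(1-s), \<open>Landau_term\<close> is the Taylor remainder at u = 1/n
  of (1+u)^(1-s), expanded at 0 to degree K + 1. The constant depends on s only through R, which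
  makes the bound locally uniform in s.\<close>

lemma Landau_term_bound:
  assumes s: "norm s \<le> R" and n: "n \<ge> 1"
  shows "norm (Landau_term K n s) \<le>
    ((2 + R + real K) ^ Suc (Suc K) * 2 powr (R + real K + 1)) / fact (Suc K) * real n powr - (Re s + real K + 1)"
proof -
  have R: "R \<ge> 0" using s norm_ge_zero order_trans by blast
  \<comment> \<open>\<open>f i\<close> is the i-th derivative of (1+u)^(1-s). In \<open>B\<close>,
    each of the K + 2 factors 1 - s - k has norm at most 2 + R + K, and 1 \<le> |1+u| \<le> 2 on the
    segment bounds the power.\<close>
  define f where "f = (\<lambda>i u. (\<Prod>k<i. 1 - s - of_nat k) * (1 + u) powr (1 - s - of_nat i))"
  define B where "B = (2 + R + real K) ^ Suc (Suc K) * 2 powr (R + real K + 1)"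
  define z where "z = (1 / of_nat n :: complex)"
  let ?S = "closed_segment 0 z"
  have seg: "\<exists>v. u = of_real v \<and> 0 \<le> v \<and> v \<le> 1" if "u \<in> ?S" for u
  proof -
    have "\<exists>t. 0 \<le> t \<and> t \<le> 1 \<and> u = (1 - t) *\<^sub>R 0 + t *\<^sub>R z"
      using that by (simp only: in_segment)
    then obtain t where t: "0 \<le> t" "t \<le> 1" "u = of_real (t / real n)"
      by (auto simp: z_def scaleR_conv_of_real)
    moreover have "t / real n \<le> 1" using t(2) n by (simp add: divide_le_eq)
    ultimately show ?thesis by (intro exI[of _ "t / real n"]) auto
  qed
  have "norm (f 0 z - (\<Sum>i\<le>Suc K. f i 0 * (z - 0) ^ i / fact i)) \<le> B * norm (z - 0) ^ Suc (Suc K) / fact (Suc K)"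
  proof (rule complex_Taylor[where S = ?S])
    fix i u assume u: "u \<in> ?S"
    obtain v where v: "u = of_real v" "0 \<le> v" "v \<le> 1" using seg[OF u] by blast
    have "1 + u = of_real (1 + v)" using v by simp
    then have "1 + u \<notin> \<real>\<^sub>\<le>\<^sub>0" using v by (metis add_nonneg_eq_0_iff add_nonneg_nonneg antisym_conv complex_nonpos_Reals_iff Re_complex_of_real zero_le_one zero_neq_one)
    then have "((\<lambda>u. (1 + u) powr (1 - s - of_nat i)) has_field_derivative
       (1 - s - of_nat i) * (1 + u) powr (1 - s - of_nat i - 1)) (at u within ?S)"
      by (auto intro!: derivative_eq_intros has_field_derivative_powr)
    from DERIV_cmult[OF this, of "\<Prod>k<i. 1 - s - of_nat k"]
    show "(f i has_field_derivative f (Suc i) u) (at u within ?S)"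
      by (simp add: f_def algebra_simps)
  next
    fix u assume u: "u \<in> ?S"
    obtain v where v: "u = of_real v" "0 \<le> v" "v \<le> 1" using seg[OF u] by blast
    have "norm (\<Prod>k<Suc (Suc K). 1 - s - of_nat k) = (\<Prod>k<Suc (Suc K). norm (1 - s - of_nat k))"
      by (rule prod_norm[symmetric])
    also have "\<dots> \<le> (\<Prod>k<Suc (Suc K). 2 + R + real K)"
    proof (rule prod_mono, safe)
      fix k assume "k < Suc (Suc K)"
      have "norm (1 - s - of_nat k) \<le> norm (1 - s) + norm (of_nat k :: complex)" by (rule norm_triangle_ineq4)
      also have "\<dots> \<le> norm (1 :: complex) + norm s + norm (of_nat k :: complex)"
        using norm_triangle_ineq4[of 1 s] by simp
      also have "\<dots> \<le> 2 + R + real K" using s \<open>k < _\<close> by simp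
      finally show "norm (1 - s - of_nat k) \<le> 2 + R + real K" .
    qed auto
    finally have 1: "norm (\<Prod>k<Suc (Suc K). 1 - s - of_nat k) \<le> (2 + R + real K) ^ Suc (Suc K)" by simp
    have "norm ((1 + u) powr (1 - s - of_nat (Suc (Suc K)))) = (1 + v) powr (- Re s - real K - 1)"
      using v norm_powr_real_powr[of "1 + u" "1 - s - of_nat (Suc (Suc K))"] by simp
    also have "\<dots> \<le> (1 + v) powr (R + real K + 1)"
      using v s abs_Re_le_cmod[of s] R by (intro powr_mono) auto
    also have "\<dots> \<le> 2 powr (R + real K + 1)"
      using v R by (intro powr_mono2) auto
    finally have 2: "norm ((1 + u) powr (1 - s - of_nat (Suc (Suc K)))) \<le> 2 powr (R + real K + 1)" .
    show "norm (f (Suc (Suc K)) u) \<le> B"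
      unfolding f_def B_def norm_mult using 1 2 R by (intro mult_mono) auto
  qed auto
  also have "norm (z - 0) = 1 / real n" using n by (simp add: z_def norm_divide)
  finally have *: "norm (f 0 z - (\<Sum>i\<le>Suc K. f i 0 * z ^ i / fact i)) \<le> B * (1 / real n) ^ Suc (Suc K) / fact (Suc K)"
    by simp
  have nz: "of_nat n \<noteq> (0 :: complex)" using n by simp
  have pw: "of_nat n powr (1 - s) * z ^ Suc j = of_nat n powr (- s - of_nat j)" for j
  proof -
    have "of_nat n powr (- s - of_nat j) = of_nat n powr (1 - s - of_nat (Suc j))" by simp
    also have "\<dots> = of_nat n powr (1 - s) / of_nat n ^ Suc j"
      using nz by (subst powr_diff) (auto simp del: of_nat_Suc simp: powr_nat)
    finally show ?thesis by (simp add: z_def power_divide)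
  qed
  have "of_nat n powr (1 - s) * f 0 z = (of_nat n * (1 + z)) powr (1 - s)"
    unfolding f_def using n by (subst powr_times_real) (auto simp: z_def)
  also have "of_nat n * (1 + z) = of_nat (Suc n)" using nz by (simp add: z_def field_simps)
  finally have f0: "of_nat n powr (1 - s) * f 0 z = of_nat (Suc n) powr (1 - s)" .
  have "of_nat n powr (1 - s) * (\<Sum>i\<le>Suc K. f i 0 * z ^ i / fact i) =
     of_nat n powr (1 - s) + (\<Sum>j\<le>K. of_nat n powr (1 - s) * (f (Suc j) 0 * z ^ Suc j / fact (Suc j)))"
    by (subst sum.atMost_Suc_shift) (simp add: f_def distrib_left sum_distrib_left)
  also have "(\<Sum>j\<le>K. of_nat n powr (1 - s) * (f (Suc j) 0 * z ^ Suc j / fact (Suc j))) =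
     (\<Sum>j\<le>K. (\<Prod>k\<le>j. 1 - s - of_nat k) / fact (Suc j) * of_nat n powr (- s - of_nat j))"
    by (rule sum.cong[OF refl], unfold pw[symmetric]) (simp add: f_def lessThan_Suc_atMost del: fact_Suc power_Suc)
  finally have "Landau_term K n s = of_nat n powr (1 - s) * (f 0 z - (\<Sum>i\<le>Suc K. f i 0 * z ^ i / fact i))"
    by (simp add: Landau_term_def right_diff_distrib f0)
  then have "norm (Landau_term K n s) = real n powr (1 - Re s) * norm (f 0 z - (\<Sum>i\<le>Suc K. f i 0 * z ^ i / fact i))"
    using n by (simp add: norm_mult norm_of_nat_powr)
  also have "\<dots> \<le> real n powr (1 - Re s) * (B * (1 / real n) ^ Suc (Suc K) / fact (Suc K))"
    by (intro mult_left_mono * powr_ge_zero)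
  also have "\<dots> = B / fact (Suc K) * (real n powr (1 - Re s) * real n powr - (real K + 2))"
  proof -
    have "(1 / real n) ^ Suc (Suc K) = real n powr - (real K + 2)"
      using n powr_realpow[of "real n" "Suc (Suc K)"] unfolding powr_minus
      by (simp add: power_divide divide_inverse power_inverse add_ac del: power_Suc)
    then show ?thesis by simp
  qed
  also have "real n powr (1 - Re s) * real n powr - (real K + 2) = real n powr - (Re s + real K + 1)"
    using n by (simp add: powr_add[symmetric])
  finally show ?thesis unfolding B_def .
qed

lemma holomorphic_Landau_term: "n \<ge> 1 \<Longrightarrow> Landau_term K n holomorphic_on S"
  unfolding Landau_term_def by (auto intro!: holomorphic_intros)

lemma Landau_term_local_bound:
  assumes "Re z > - real K"
  shows "\<exists>d C e. d > 0 \<and> e > 1 \<and>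
       (\<forall>\<^sub>F n in sequentially. \<forall>y\<in>ball z d \<inter> {s. Re s > - real K}. norm (Landau_term K n y) \<le> C * real n powr - e)"
proof (intro exI conjI)
  define d where "d = (Re z + real K) / 2"
  define C where "C = ((2 + (norm z + d) + real K) ^ Suc (Suc K) * 2 powr ((norm z + d) + real K + 1)) / fact (Suc K)"
  show d: "d > 0" "1 + d > 1" using assms by (auto simp: d_def)
  show "\<forall>\<^sub>F n in sequentially. \<forall>y\<in>ball z d \<inter> {s. Re s > - real K}. norm (Landau_term K n y) \<le> C * real n powr - (1 + d)"
    using eventually_ge_at_top[of 1]
  proof eventually_elim
    case (elim n)
    show ?case
    proof
      fix y assume "y \<in> ball z d \<inter> {s. Re s > - real K}"
      then have y: "norm (z - y) < d" by (simp add: dist_norm)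
      then have "Re (z - y) < d" using complex_Re_le_cmod[of "z - y"] by linarith
      then have y': "1 + d \<le> Re y + real K + 1" by (simp add: d_def field_simps)
      have "norm y \<le> norm z + d" using norm_triangle_sub[of y z] y by (simp add: norm_minus_commute)
      from Landau_term_bound[OF this elim, of K]
      have "norm (Landau_term K n y) \<le> C * real n powr - (Re y + real K + 1)" unfolding C_def .
      also have "\<dots> \<le> C * real n powr - (1 + d)"
        using y' elim d by (intro mult_left_mono powr_mono) (auto simp: C_def)
      finally show "norm (Landau_term K n y) \<le> C * real n powr - (1 + d)" .
    qed
  qed
qed

text \<open>The bare series is kept apart from \<open>zeta\<close>, because nothing is known about
  the chosen function until a continuation has been constructed from this series.\<close>

abbreviation zeta_sum :: "complex \<Rightarrow> complex" where
  "zeta_sum s \<equiv> \<Sum>\<^sub>\<infinity>n\<in>{1::nat..}. of_nat n powr - s"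

lemma
  fixes s :: complex
  shows zeta_sum_sums: "Re s > 1 \<Longrightarrow> (\<lambda>n. of_nat (Suc n) powr - s) sums zeta_sum s"
  and holomorphic_zeta_sum: "zeta_sum holomorphic_on {s. Re s > 1}"
  and deriv_zeta_sum_sums: "Re s > 1 \<Longrightarrow>
        (\<lambda>n. - ln (real (Suc n)) * of_nat (Suc n) powr - s) sums deriv zeta_sum s"
proof -
  have *: "(\<lambda>n. 1) \<in> O(\<lambda>n. of_real (real n powr - 0) :: complex)"
    by (rule bigoI[where c = 1]) (use eventually_ge_at_top[of 1] in \<open>auto elim!: eventually_mono\<close>)
  have 1: "(\<lambda>n. of_nat n powr - s) summable_on {1::nat..}" if "Re s > 1"
    using Dirichlet_series(1)[OF *, of s] that by simp
  show "(\<lambda>n. of_nat (Suc n) powr - s) sums zeta_sum s" if "Re s > 1"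
    using summable_on_atLeast_1_sums[OF 1[OF that]] by simp
  show "zeta_sum holomorphic_on {s. Re s > 1}"
    using Dirichlet_series(3)[OF *, of 2] by simp
  show "(\<lambda>n. - ln (real (Suc n)) * of_nat (Suc n) powr - s) sums deriv zeta_sum s" if "Re s > 1"
    using Dirichlet_series(2)[OF *, of s] that by simp
qed

lemma Landau_term_series:
  assumes "Re s > - real K"
  shows "(\<lambda>n. Landau_term K (Suc n) s) sums (\<Sum>\<^sub>\<infinity>n\<in>{1..}. Landau_term K n s)"
    and "(\<lambda>n. deriv (Landau_term K (Suc n)) s) sums deriv (\<lambda>s. \<Sum>\<^sub>\<infinity>n\<in>{1..}. Landau_term K n s) s"
    and "(\<lambda>s. \<Sum>\<^sub>\<infinity>n\<in>{1..}. Landau_term K n s) holomorphic_on {s. Re s > - real K}"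
proof -
  note * = infsum_has_derivative_local[of "{s. Re s > - real K}" "Landau_term K" s,
     OF open_halfspace_Re_gt holomorphic_Landau_term Landau_term_local_bound]
  have S: "s \<in> {s. Re s > - real K}" using assms by simp
  show "(\<lambda>n. deriv (Landau_term K (Suc n)) s) sums deriv (\<lambda>s. \<Sum>\<^sub>\<infinity>n\<in>{1..}. Landau_term K n s) s"
    "(\<lambda>s. \<Sum>\<^sub>\<infinity>n\<in>{1..}. Landau_term K n s) holomorphic_on {s. Re s > - real K}"
    using *(2,3) S by auto
  have "(\<lambda>n. Landau_term K n s) summable_on {1..}" using *(1) S by auto
  then show "(\<lambda>n. Landau_term K (Suc n) s) sums (\<Sum>\<^sub>\<infinity>n\<in>{1..}. Landau_term K n s)"
    by (rule summable_on_atLeast_1_sums)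
qed

text \<open>The difference of powers telescopes to -1 and the term j = 0 gives (1 - s) times the
  series. For j \<ge> 1 the last factor 1 - s - j of the product is split off, so that each shifted
  series appears as (s+j-1) \<zeta>(s+j), the form in which it has no pole.\<close>

lemma zeta_sum_Landau:
  assumes s: "Re s > 1"
  shows "(s - 1) * zeta_sum s = 1 + (\<Sum>\<^sub>\<infinity>n\<in>{1..}. Landau_term K n s)
     - (\<Sum>j=1..K. (\<Prod>k<j. 1 - s - of_nat k) / fact (Suc j) * ((s + of_nat j - 1) * zeta_sum (s + of_nat j)))"
proof -
  let ?c = "\<lambda>j. (\<Prod>k\<le>j. 1 - s - of_nat k) / fact (Suc j)"
  have lim: "(\<lambda>n. of_nat (Suc n) powr (1 - s)) \<longlonglongrightarrow> 0"
  proof (rule Lim_null_comparison[where g = "\<lambda>n. real (Suc n) powr (1 - Re s)"])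
    show "\<forall>\<^sub>F n in sequentially. norm (of_nat (Suc n) powr (1 - s)) \<le> real (Suc n) powr (1 - Re s)"
      by (intro always_eventually allI) (subst norm_of_nat_powr, auto)
    show "(\<lambda>n. real (Suc n) powr (1 - Re s)) \<longlonglongrightarrow> 0"
      by (rule LIMSEQ_Suc, rule tendsto_neg_powr)
         (use s in \<open>auto intro: filterlim_real_sequentially\<close>)
  qed
  have "(\<lambda>n. of_nat (Suc (Suc n)) powr (1 - s) - of_nat (Suc n) powr (1 - s)) sums (0 - of_nat (Suc 0) powr (1 - s))"
    by (rule telescope_sums[OF lim])
  moreover have "(\<lambda>n. of_nat (Suc n) powr (- s - of_nat j)) sums zeta_sum (s + of_nat j)" for j
    using zeta_sum_sums[of "s + of_nat j"] s by (simp add: minus_diff_commute del: of_nat_Suc)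
  then have "(\<lambda>n. \<Sum>j\<le>K. ?c j * of_nat (Suc n) powr (- s - of_nat j)) sums (\<Sum>j\<le>K. ?c j * zeta_sum (s + of_nat j))"
    by (intro sums_sum sums_mult)
  ultimately have "(\<lambda>n. Landau_term K (Suc n) s) sums (0 - of_nat (Suc 0) powr (1 - s) - (\<Sum>j\<le>K. ?c j * zeta_sum (s + of_nat j)))"
    unfolding Landau_term_def by (rule sums_diff)
  moreover have "(\<lambda>n. Landau_term K (Suc n) s) sums (\<Sum>\<^sub>\<infinity>n\<in>{1..}. Landau_term K n s)"
    by (rule Landau_term_series) (use s in auto)
  ultimately have "(\<Sum>\<^sub>\<infinity>n\<in>{1..}. Landau_term K n s) = - 1 - (\<Sum>j\<le>K. ?c j * zeta_sum (s + of_nat j))"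
    by (auto dest: sums_unique2)
  also have "{..K} = insert 0 {1..K}" by auto
  also have "(\<Sum>j\<in>insert 0 {1..K}. ?c j * zeta_sum (s + of_nat j)) =
     (1 - s) * zeta_sum s + (\<Sum>j=1..K. ?c j * zeta_sum (s + of_nat j))"
    by simp
  also have "(\<Sum>j=1..K. ?c j * zeta_sum (s + of_nat j)) =
     - (\<Sum>j=1..K. (\<Prod>k<j. 1 - s - of_nat k) / fact (Suc j) * ((s + of_nat j - 1) * zeta_sum (s + of_nat j)))"
  proof -
    have "(\<Prod>k\<le>j. 1 - s - of_nat k) = - ((\<Prod>k<j. 1 - s - of_nat k) * (s + of_nat j - 1))" for j
      by (simp add: lessThan_Suc_atMost[symmetric] algebra_simps)
    then show ?thesis
      unfolding sum_negf[symmetric] by (intro sum.cong) (simp_all del: fact_Suc)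
  qed
  finally show ?thesis by (simp add: algebra_simps)
qed

text \<open>The right-hand side of \<open>zeta_sum_Landau\<close> evaluates (s-1) \<zeta>(s) at
  points shifted to the right by at least 1, so each use of it gains one unit. The Landau series of
  order K is holomorphic on the new half-plane Re s > -K.\<close>

lemma zeta_continuation_halfplane:
  "\<exists>Z. Z holomorphic_on {s. Re s > 1 - real K} \<and> (\<forall>s. Re s > 1 \<longrightarrow> Z s = (s - 1) * zeta_sum s)"
proof (induction K)
  case 0
  show ?case
  proof (intro exI conjI)
    show "(\<lambda>s. (s - 1) * zeta_sum s) holomorphic_on {s. Re s > 1 - real 0}"
      unfolding of_nat_0 diff_zero by (intro holomorphic_intros holomorphic_zeta_sum)
  qed simp
next
  case (Suc K)
  then obtain Z where Z: "Z holomorphic_on {s. Re s > 1 - real K}"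
    "\<And>s :: complex. Re s > 1 \<Longrightarrow> Z s = (s - 1) * zeta_sum s" by blast
  define Z' where "Z' = (\<lambda>s. 1 + (\<Sum>\<^sub>\<infinity>n\<in>{1..}. Landau_term K n s)
     - (\<Sum>j=1..K. (\<Prod>k<j. 1 - s - of_nat k) / fact (Suc j) * Z (s + of_nat j)))"
  have "(\<lambda>s. Z (s + of_nat j)) holomorphic_on {s. Re s > - real K}" if "j \<in> {1..K}" for j
    by (rule holomorphic_on_compose_gen[OF _ Z(1), unfolded o_def])
       (use that in \<open>auto intro!: holomorphic_intros\<close>)
  moreover have "(\<lambda>s. \<Sum>\<^sub>\<infinity>n\<in>{1..}. Landau_term K n s) holomorphic_on {s. Re s > - real K}"
    by (rule Landau_term_series(3)[of _ 1]) auto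
  ultimately have "Z' holomorphic_on {s. Re s > - real K}"
    unfolding Z'_def by (auto intro!: holomorphic_intros simp del: fact_Suc)
  moreover have "Z' s = (s - 1) * zeta_sum s" if "Re s > 1" for s
    unfolding zeta_sum_Landau[OF that, of K] Z'_def using that Z(2) by simp
  ultimately show ?case by (intro exI[of _ Z']) auto
qed

lemma zeta_continuation_entire:
  obtains Z where "Z holomorphic_on UNIV" "\<And>s :: complex. Re s > 1 \<Longrightarrow> Z s = (s - 1) * zeta_sum s"
proof -
  from zeta_continuation_halfplane obtain Y where
    Y: "\<And>K. Y K holomorphic_on {s. Re s > 1 - real K}" "\<And>K (s :: complex). Re s > 1 \<Longrightarrow> Y K s = (s - 1) * zeta_sum s"
    by metis
  have eq: "Y K s = Y L s" if "K \<le> L" "Re s > 1 - real K" for K L and s :: complex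
  proof (rule analytic_continuation_open[of "{s. Re s > 1}" "{s. Re s > 1 - real K}" "Y K" "Y L"])
    show "{s :: complex. Re s > 1} \<noteq> {}" by (auto intro: exI[of _ 2])
    show "Y L holomorphic_on {s. Re s > 1 - real K}"
      by (rule holomorphic_on_subset[OF Y(1)]) (use that in auto)
  qed (use that Y in \<open>auto intro: open_halfspace_Re_gt convex_connected convex_halfspace_Re_gt\<close>)
  \<comment> \<open>Any K with Re s > 1 - K may serve at s, since the half-plane functions agree on
    common domains; this is one such K.\<close>
  define N where "N = (\<lambda>s. nat \<lceil>2 - Re s\<rceil>)"
  have N: "Re s > 1 - real (N s)" for s unfolding N_def by linarith
  define Z where "Z = (\<lambda>s. Y (N s) s)"
  have ZY: "Z s = Y K s" if "Re s > 1 - real K" for s K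
  proof (cases "N s \<le> K")
    case True
    then show ?thesis unfolding Z_def using eq[OF _ N] by blast
  next
    case False
    then show ?thesis unfolding Z_def using eq[of K "N s" s] that by simp
  qed
  show ?thesis
  proof (rule that)
    have "Z field_differentiable at s" for s
    proof -
      have "Z holomorphic_on {w. Re w > 1 - real (N s)}"
        by (rule holomorphic_transform[OF Y(1)[of "N s"]]) (use ZY in auto)
      then show ?thesis
        using N[of s] by (auto simp: holomorphic_on_open open_halfspace_Re_gt field_differentiable_def)
    qed
    then show "Z holomorphic_on UNIV" by (simp add: holomorphic_on_def)
    show "Z s = (s - 1) * zeta_sum s" if "Re s > 1" for s using Y(2) that by (simp add: Z_def)
  qed
qed

text \<open>The right-hand side is the general term of the series for \<gamma>, so order K = 0
  suffices to find the derivative of (s-1) \<zeta>(s) at 1.\<close>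

lemma deriv_Landau_term_0_at_1:
  "deriv (Landau_term 0 (Suc n)) 1 = inverse (of_nat (Suc n)) + of_real (ln (real (Suc n)) - ln (real (Suc (Suc n))))"
proof (rule DERIV_imp_deriv)
  have L: "Landau_term 0 (Suc n) = (\<lambda>s. exp ((1 - s) * of_real (ln (real (Suc (Suc n)))))
    - exp ((1 - s) * of_real (ln (real (Suc n)))) - (1 - s) * exp (- s * of_real (ln (real (Suc n)))))"
  proof
    fix s
    have [simp]: "of_nat (Suc 0) = (1 :: complex)" by simp
    show "Landau_term 0 (Suc n) s = exp ((1 - s) * of_real (ln (real (Suc (Suc n)))))
        - exp ((1 - s) * of_real (ln (real (Suc n)))) - (1 - s) * exp (- s * of_real (ln (real (Suc n))))"
      by (simp add: Landau_term_def powr_def Ln_of_nat del: of_nat_Suc)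
  qed
  have "exp (- of_real (ln (real (Suc n)))) = inverse (of_nat (Suc n) :: complex)"
    by (simp add: exp_minus exp_of_real del: of_nat_Suc)
  then show "(Landau_term 0 (Suc n) has_field_derivative
     inverse (of_nat (Suc n)) + of_real (ln (real (Suc n)) - ln (real (Suc (Suc n))))) (at 1)"
    unfolding L by (auto intro!: derivative_eq_intros simp del: of_nat_Suc)
qed

text \<open>The identity theorem identifies the choice \<open>zeta\<close> with Z(s)/(s-1) for an
  entire Z. The Landau identity for K = 0, whose sum over j is empty, gives Z(1) = 1 and Z'(1) =
  \<gamma>; these are the residue and the constant term of \<open>zeta\<close> at 1.\<close>

lemma zeta_properties:
  shows "zeta holomorphic_on - {1}" and "\<And>s :: complex. Re s > 1 \<Longrightarrow> zeta s = zeta_sum s"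
    and "\<exists>E. E holomorphic_on UNIV \<and> E 0 = 0 \<and> (\<forall>w. w \<noteq> 0 \<longrightarrow> zeta (1 + w) = 1 / w + euler_mascheroni + E w)"
proof -
  obtain Z where Z: "Z holomorphic_on UNIV" "\<And>s :: complex. Re s > 1 \<Longrightarrow> Z s = (s - 1) * zeta_sum s"
    by (rule zeta_continuation_entire) blast
  have sum_eq: "(\<Sum>\<^sub>\<infinity>n\<in>{1::nat..}. 1 / of_nat n powr s) = zeta_sum s" for s :: complex
    by (simp add: powr_minus divide_inverse)
  have "(\<lambda>s. Z s / (s - 1)) holomorphic_on - {1} \<and>
     (\<forall>s. Re s > 1 \<longrightarrow> Z s / (s - 1) = (\<Sum>\<^sub>\<infinity>n\<in>{1::nat..}. 1 / of_nat n powr s))"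
    unfolding sum_eq using Z(2) by (auto intro!: holomorphic_intros holomorphic_on_subset[OF Z(1)])
  from exI[of "\<lambda>F. F holomorphic_on - {1} \<and> (\<forall>s. Re s > 1 \<longrightarrow> F s = (\<Sum>\<^sub>\<infinity>n\<in>{1::nat..}. 1 / of_nat n powr s))", OF this]
  have "zeta holomorphic_on - {1} \<and> (\<forall>s. Re s > 1 \<longrightarrow> zeta s = (\<Sum>\<^sub>\<infinity>n\<in>{1::nat..}. 1 / of_nat n powr s))"
    unfolding zeta_def by (rule someI_ex)
  then show hol: "zeta holomorphic_on - {1}" and eq: "\<And>s :: complex. Re s > 1 \<Longrightarrow> zeta s = zeta_sum s"
    unfolding sum_eq by auto
  have zeta_Z: "zeta s = Z s / (s - 1)" if "s \<noteq> 1" for s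
  proof (rule analytic_continuation_open[of "{s. Re s > 1}" "- {1}" zeta])
    show "{s :: complex. Re s > 1} \<noteq> {}" by (auto intro: exI[of _ 2])
    show "connected (- {1 :: complex})" by (rule connected_punctured_universe) auto
    show "(\<lambda>s. Z s / (s - 1)) holomorphic_on - {1}"
      by (auto intro!: holomorphic_intros holomorphic_on_subset[OF Z(1)])
  qed (use that Z eq hol in \<open>auto intro: open_halfspace_Re_gt\<close>)
  let ?G = "\<lambda>s. 1 + (\<Sum>\<^sub>\<infinity>n\<in>{1..}. Landau_term 0 n s)"
  have ZG: "Z s = ?G s" if "Re s > 0" for s
  proof (rule analytic_continuation_open[of "{s. Re s > 1}" "{s. Re s > 0}" Z])
    show "{s :: complex. Re s > 1} \<noteq> {}" by (auto intro: exI[of _ 2])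
    show "?G holomorphic_on {s. Re s > 0}"
      using Landau_term_series(3)[of 0 1] by (auto intro!: holomorphic_intros)
    show "Z s = ?G s" if "s \<in> {s. Re s > 1}" for s
      using zeta_sum_Landau[of s 0] Z(2) that by auto
  qed (use that Z in \<open>auto intro: open_halfspace_Re_gt convex_connected convex_halfspace_Re_gt holomorphic_on_subset\<close>)
  have Z1: "Z 1 = 1"
  proof -
    have "Landau_term 0 n 1 = 0" if "n \<ge> 1" for n
      using that of_nat_neq_0[of n, where ?'a = complex] by (simp add: Landau_term_def)
    then have "(\<Sum>\<^sub>\<infinity>n\<in>{1..}. Landau_term 0 n 1) = 0" by (intro infsum_0) auto
    then show ?thesis using ZG[of 1] by simp
  qed
  have Z'1: "deriv Z 1 = euler_mascheroni"
  proof -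
    have "deriv Z 1 = deriv ?G 1"
    proof (rule deriv_cong_ev)
      have "\<forall>\<^sub>F s in nhds (1::complex). s \<in> {s. Re s > 0}"
        by (rule eventually_nhds_in_open) (auto simp: open_halfspace_Re_gt)
      then show "\<forall>\<^sub>F s in nhds 1. Z s = ?G s" by eventually_elim (use ZG in auto)
    qed auto
    also have "\<dots> = deriv (\<lambda>s. \<Sum>\<^sub>\<infinity>n\<in>{1..}. Landau_term 0 n s) 1"
    proof -
      have "(\<lambda>s. \<Sum>\<^sub>\<infinity>n\<in>{1..}. Landau_term 0 n s) field_differentiable at 1"
        using Landau_term_series(3)[of 0 1]
        by (auto simp: holomorphic_on_open open_halfspace_Re_gt field_differentiable_def)
      then show ?thesis by (subst deriv_add) auto
    qed
    finally have "(\<lambda>n. inverse (of_nat (Suc n)) + of_real (ln (real (Suc n)) - ln (real (Suc (Suc n))))) sums deriv Z 1"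
      using Landau_term_series(2)[of 0 1] unfolding deriv_Landau_term_0_at_1 by simp
    moreover have "(\<lambda>n. inverse (of_nat (Suc n)) + of_real (ln (real (Suc n)) - ln (real (Suc (Suc n))))) sums (euler_mascheroni :: complex)"
      using euler_mascheroni_sum[where 'a = complex] by (simp add: algebra_simps)
    ultimately show ?thesis by (rule sums_unique2)
  qed
  \<comment> \<open>The difference quotient of \<open>Z\<close> at 1, entire because the singularity
    is removable. Thus \<zeta>(s) = 1/(s-1) + F(s), and F(1) = Z'(1) = \<gamma>.\<close>
  define F where "F = (\<lambda>s. if s = 1 then deriv Z 1 else (Z s - Z 1) / (s - 1))"
  have F: "F holomorphic_on UNIV"
    unfolding F_def by (rule pole_lemma[OF Z(1)]) auto
  show "\<exists>E. E holomorphic_on UNIV \<and> E 0 = 0 \<and> (\<forall>w. w \<noteq> 0 \<longrightarrow> zeta (1 + w) = 1 / w + euler_mascheroni + E w)"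
  proof (intro exI conjI allI impI)
    show "(\<lambda>w. F (1 + w) - euler_mascheroni) holomorphic_on UNIV"
      by (intro holomorphic_intros holomorphic_on_compose_gen[OF _ F, of "\<lambda>w. 1 + w", unfolded o_def]) auto
    show "F (1 + 0) - euler_mascheroni = 0" by (simp add: F_def Z'1)
    fix w :: complex assume "w \<noteq> 0"
    then show "zeta (1 + w) = 1 / w + euler_mascheroni + (F (1 + w) - euler_mascheroni)"
      using zeta_Z[of "1 + w"] by (simp add: F_def Z1 field_simps)
  qed
qed

lemma zeta_of_nat_sums:
  assumes "k \<ge> 2"
  shows "(\<lambda>n. inverse (of_nat (Suc n)) ^ k) sums zeta (of_nat k)"
proof -
  have "inverse (of_nat (Suc n)) ^ k = (of_nat (Suc n) powr - of_nat k :: complex)" for n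
    by (simp add: powr_minus powr_nat power_inverse del: of_nat_Suc)
  then show ?thesis
    using zeta_sum_sums[of "of_nat k"] zeta_properties(2)[of "of_nat k"] assms by simp
qed

section \<open>Expansion at the pole\<close>

lemma bigo_sub_of_holomorphic:
  assumes R: "R holomorphic_on S" and S: "open S" "a \<in> S" "R a = 0"
  shows "R \<in> O[at a](\<lambda>s. s - a)"
proof -
  have "(R has_field_derivative deriv R a) (at a)"
    by (rule holomorphic_derivI[OF R S(1,2)])
  then have "((\<lambda>s. R s / (s - a)) \<longlongrightarrow> deriv R a) (at a)"
    using S(3) by (simp add: has_field_derivative_iff)
  then show ?thesis
    by (rule bigoI_tendsto) (auto simp: eventually_at_filter)
qed

lemma bigo_imp_tendsto_0:
  assumes "f \<in> O[F](g)" "(g \<longlongrightarrow> 0) F"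
  shows "(f \<longlongrightarrow> 0) F"
proof -
  obtain c where "\<forall>\<^sub>F x in F. norm (f x) \<le> c * norm (g x)"
    using landau_o.bigE[OF assms(1)] by blast
  moreover have "((\<lambda>x. c * norm (g x)) \<longlongrightarrow> 0) F"
    using tendsto_mult_right_zero[OF tendsto_norm_zero[OF assms(2)]] .
  ultimately show ?thesis by (rule Lim_null_comparison)
qed

lemma is_pole_of_tendsto:
  fixes f :: "complex \<Rightarrow> complex"
  assumes "((\<lambda>s. f s * (s - a) ^ k) \<longlongrightarrow> c) (at a)" "c \<noteq> 0" "k > 0"
  shows "is_pole f a"
proof -
  have "((\<lambda>s. (s - a) ^ k) \<longlongrightarrow> (a - a) ^ k) (at a)" by (intro tendsto_intros)
  then have "filterlim (\<lambda>s. (s - a) ^ k) (at 0) (at a)"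
    using assms(3) by (auto simp: filterlim_at eventually_at_filter power_0_left)
  from filterlim_divide_at_infinity[OF assms(1) this assms(2)]
  have "filterlim (\<lambda>s. f s * (s - a) ^ k / (s - a) ^ k) at_infinity (at a)" .
  then show ?thesis unfolding is_pole_def
    by (rule filterlim_cong[THEN iffD1, rotated -1]) (auto simp: eventually_at_filter)
qed

text \<open>\<open>stieltjes1\<close> is a definite description, so uniqueness has to be shown as
  well. With E(z) = z H(z) the defining estimate becomes H(z) + g = O(z), which holds for just one
  g, namely -H(0) = -E'(0).\<close>

lemma stieltjes1_eq:
  assumes E: "E holomorphic_on UNIV" "E 0 = 0"
    and zeta: "\<And>w. w \<noteq> 0 \<Longrightarrow> zeta (1 + w) = 1 / w + euler_mascheroni + E w"
  shows "stieltjes1 = - deriv E 0"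
proof -
  define H where "H = (\<lambda>z. if z = 0 then deriv E 0 else (E z - E 0) / (z - 0))"
  have H: "H holomorphic_on UNIV"
    unfolding H_def by (rule pole_lemma[OF E(1)]) auto
  have E_H: "E z = z * H z" for z by (simp add: H_def E(2))
  have "(\<lambda>z. zeta (1 + z) - (1 / z + euler_mascheroni - g * z)) \<in> O[at 0](\<lambda>z. z\<^sup>2) \<longleftrightarrow> g = - deriv E 0" for g
  proof -
    have "(\<lambda>z. zeta (1 + z) - (1 / z + euler_mascheroni - g * z)) \<in> O[at 0](\<lambda>z. z\<^sup>2) \<longleftrightarrow>
        (\<lambda>z. z * (H z + g)) \<in> O[at 0](\<lambda>z. z * z)"
      unfolding power2_eq_square
      by (rule landau_o.big.in_cong, unfold eventually_at_filter, intro always_eventually allI impI)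
         (subst zeta, simp_all add: E_H algebra_simps)
    also have "\<dots> \<longleftrightarrow> (\<lambda>z. H z + g) \<in> O[at 0](\<lambda>z. z)"
      by (rule landau_o.big.mult_cancel_left) (auto simp: eventually_at_filter)
    also have "\<dots> \<longleftrightarrow> g = - deriv E 0"
    proof
      assume g: "(\<lambda>z. H z + g) \<in> O[at 0](\<lambda>z. z)"
      have "((\<lambda>z. z) \<longlongrightarrow> 0) (at (0 :: complex))" by (rule tendsto_ident_at)
      with g have 1: "((\<lambda>z. H z + g) \<longlongrightarrow> 0) (at 0)" by (rule bigo_imp_tendsto_0)
      have "isCont H 0"
        using holomorphic_on_imp_continuous_on[OF H] by (simp add: continuous_on_eq_continuous_at)
      then have "((\<lambda>z. H z + g) \<longlongrightarrow> H 0 + g) (at 0)"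
        by (intro tendsto_intros) (simp add: isCont_def)
      from tendsto_unique[OF _ this 1] have "H 0 + g = 0" by simp
      then show "g = - deriv E 0" by (simp add: H_def eq_neg_iff_add_eq_0 add.commute)
    next
      assume "g = - deriv E 0"
      then have "(\<lambda>z. H z + g) \<in> O[at 0](\<lambda>z. z - 0)"
        by (intro bigo_sub_of_holomorphic[of _ UNIV] holomorphic_intros H) (auto simp: H_def)
      then show "(\<lambda>z. H z + g) \<in> O[at 0](\<lambda>z. z)" by simp
    qed
    finally show ?thesis .
  qed
  then show ?thesis unfolding stieltjes1_def by simp
qed

text \<open>At a one has s + t = 1, so with w = s - a all coefficients are read off from the Laurent
  expansion of \<zeta>(1+w) and its derivative. The remainder series is holomorphic for Re s > 1/2 -
  t, a half-plane that contains a.\<close>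

lemma Dirichlet_log_expansion:
  fixes f :: "complex \<Rightarrow> complex" and F b :: "nat \<Rightarrow> complex" and A B :: complex and t :: nat
  defines "a \<equiv> 1 - of_nat t"
  assumes hol: "f holomorphic_on {s. Re s > - real t} - {a}"
    and f: "\<And>s. Re s > 2 \<Longrightarrow> (\<lambda>n. F (Suc n) * of_nat (Suc n) powr - s) sums f s"
    and F: "\<And>m. m \<ge> 1 \<Longrightarrow> F m = (A + B * ln (real m)) / of_nat m ^ t + b m"
    and b: "b \<in> O(\<lambda>m. of_real (real m powr - (real t + 1 / 2)))"
  shows "(\<lambda>s. f s - (B / (s - a)\<^sup>2 + A / (s - a) + (A * euler_mascheroni + B * stieltjes1
            + (\<Sum>\<^sub>\<infinity>m\<in>{1..}. b m * of_nat m ^ t / of_nat m)))) \<in> O[at a](\<lambda>s. s - a)"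
      (is "?D \<in> _")
    and "A \<noteq> 0 \<or> B \<noteq> 0 \<Longrightarrow> is_pole f a"
proof -
  obtain E where E: "E holomorphic_on UNIV" "E 0 = 0"
    and zeta_E: "\<And>w. w \<noteq> 0 \<Longrightarrow> zeta (1 + w) = 1 / w + euler_mascheroni + E w"
    using zeta_properties(3) by blast
  define H where "H = (\<lambda>s. \<Sum>\<^sub>\<infinity>m\<in>{1..}. b m * of_nat m powr - s)"
  define S where "S = {s. Re s > 1 / 2 - real t}"
  have S: "open S" "a \<in> S" "connected S"
    by (auto simp: S_def a_def open_halfspace_Re_gt convex_connected convex_halfspace_Re_gt)
  have H: "H holomorphic_on S"
    using Dirichlet_series(3)[OF b, of 2] by (simp add: H_def S_def)
  have H': "(\<lambda>n. b (Suc n) * of_nat (Suc n) powr - s) sums H s" if "s \<in> S" for s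
    using summable_on_atLeast_1_sums[OF Dirichlet_series(1)[OF b, of s]] that by (simp add: H_def S_def)
  \<comment> \<open>Here m^(-a) = m^(t-1), written m^t / m because t may be 0.\<close>
  have Ha: "H a = (\<Sum>\<^sub>\<infinity>m\<in>{1..}. b m * of_nat m ^ t / of_nat m)"
    unfolding H_def
  proof (rule infsum_cong)
    fix m :: nat assume "m \<in> {1..}"
    then have "of_nat m powr - a = of_nat m ^ t / (of_nat m :: complex)"
      by (simp add: a_def powr_diff powr_nat)
    then show "b m * of_nat m powr - a = b m * of_nat m ^ t / of_nat m" by simp
  qed
  have E': "deriv E holomorphic_on UNIV" by (intro holomorphic_deriv E) auto
  define G where "G = (\<lambda>s. A * (1 / (s - a) + euler_mascheroni + E (s - a)) + B / (s - a)\<^sup>2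
     - B * deriv E (s - a) + H s)"
  have comp: "(\<lambda>s. E (s - a)) holomorphic_on T" "(\<lambda>s. deriv E (s - a)) holomorphic_on T" for T
    by (rule holomorphic_on_compose_gen[OF _ E(1), unfolded o_def]
             holomorphic_on_compose_gen[OF _ E', unfolded o_def]; auto intro!: holomorphic_intros)+
  have fG: "f s = G s" if "Re s > 2" for s
  proof -
    define w where "w = s - a"
    have u: "Re (1 + w) > 1" and w0: "w \<noteq> 0" using that by (auto simp: w_def a_def)
    have wa: "1 + w = s + of_nat t" by (simp add: w_def a_def)
    have z: "zeta_sum (1 + w) = 1 / w + euler_mascheroni + E w"
      using zeta_properties(2)[OF u] zeta_E[OF w0] by simp
    \<comment> \<open>The derivative of the series is found through the Laurent expansion, which
      represents the series on all of Re u > 1.\<close>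
    have "(zeta_sum has_field_derivative - 1 / w\<^sup>2 + deriv E w) (at (1 + w))"
    proof (rule has_field_derivative_transform_within_open)
      show "((\<lambda>u. 1 / (u - 1) + euler_mascheroni + E (u - 1)) has_field_derivative - 1 / w\<^sup>2 + deriv E w) (at (1 + w))"
      proof -
        have "(E has_field_derivative deriv E w) (at ((1 + w) - 1))"
          using holomorphic_derivI[OF E(1), of w] by simp
        then have "((\<lambda>u. E (u - 1)) has_field_derivative deriv E w * 1) (at (1 + w))"
          by (rule DERIV_chain2) (auto intro!: derivative_eq_intros)
        then show ?thesis
          by (auto intro!: derivative_eq_intros simp: w0 power2_eq_square)
      qed
      show "open {s. Re s > 1}" by (rule open_halfspace_Re_gt)
      show "1 + w \<in> {s. Re s > 1}" using u by simp
      fix u :: complex assume "u \<in> {s. Re s > 1}"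
      then have "Re u > 1" "u - 1 \<noteq> 0" by auto
      then show "1 / (u - 1) + euler_mascheroni + E (u - 1) = zeta_sum u"
        using zeta_properties(2)[of u] zeta_E[of "u - 1"] by simp
    qed
    then have dz: "deriv zeta_sum (1 + w) = - 1 / w\<^sup>2 + deriv E w" by (rule DERIV_imp_deriv)
    have "s \<in> S" using that by (simp add: S_def)
    have "(\<lambda>n. A * of_nat (Suc n) powr - (1 + w) - B * (- ln (real (Suc n)) * of_nat (Suc n) powr - (1 + w))
        + b (Suc n) * of_nat (Suc n) powr - s) sums (A * zeta_sum (1 + w) - B * deriv zeta_sum (1 + w) + H s)"
      by (intro sums_add sums_diff sums_mult zeta_sum_sums deriv_zeta_sum_sums u H' \<open>s \<in> S\<close>)
    also have "(\<lambda>n. A * of_nat (Suc n) powr - (1 + w) - B * (- ln (real (Suc n)) * of_nat (Suc n) powr - (1 + w))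
        + b (Suc n) * of_nat (Suc n) powr - s) = (\<lambda>n. F (Suc n) * of_nat (Suc n) powr - s)"
    proof
      fix n
      have "of_nat (Suc n) powr - (1 + w) = of_nat (Suc n) powr - s / (of_nat (Suc n) ^ t :: complex)"
        unfolding wa by (simp add: powr_diff powr_nat del: of_nat_Suc)
      then show "A * of_nat (Suc n) powr - (1 + w) - B * (- ln (real (Suc n)) * of_nat (Suc n) powr - (1 + w))
        + b (Suc n) * of_nat (Suc n) powr - s = F (Suc n) * of_nat (Suc n) powr - s"
        by (subst F) (auto simp: field_simps simp del: of_nat_Suc)
    qed
    finally have "f s = A * zeta_sum (1 + w) - B * deriv zeta_sum (1 + w) + H s"
      using f[OF that] sums_unique2 by blast
    also have "\<dots> = G s" unfolding z dz G_def w_def[symmetric] by (simp add: algebra_simps)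
    finally show ?thesis .
  qed
  \<comment> \<open>The Dirichlet series represents \<open>f\<close> for Re s > 2. The half-plane
    \<open>S\<close> stays connected when a is removed, so the equality extends to a punctured
    neighbourhood of a.\<close>
  have fG': "f s = G s" if "s \<in> S - {a}" for s
  proof (rule analytic_continuation_open[of "{s. Re s > 2}" "S - {a}" f G])
    show "open {s. Re s > 2}" by (rule open_halfspace_Re_gt)
    show "{s :: complex. Re s > 2} \<noteq> {}" by (auto intro: exI[of _ 3])
    show "open (S - {a})" using S by auto
    show "connected (S - {a})" using S by (intro connected_open_delete) auto
    show "{s. Re s > 2} \<subseteq> S - {a}" by (auto simp: S_def a_def)
    show "f holomorphic_on S - {a}" by (rule holomorphic_on_subset[OF hol]) (auto simp: S_def)
    show "G holomorphic_on S - {a}" unfolding G_def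
      by (intro holomorphic_intros comp holomorphic_on_subset[OF H]) auto
  qed (use that fG in auto)
  \<comment> \<open>The part of the expansion that vanishes at a: E(0) = 0, and the values
    \<open>deriv E 0\<close> and \<open>H a\<close> have gone into the constant coefficient. Being
    holomorphic at a, it is O(s - a).\<close>
  define R where "R = (\<lambda>s. A * E (s - a) - B * (deriv E (s - a) - deriv E 0) + (H s - H a))"
  have "R holomorphic_on S" unfolding R_def by (intro holomorphic_intros comp H)
  then have R: "R \<in> O[at a](\<lambda>s. s - a)"
    by (rule bigo_sub_of_holomorphic) (use S in \<open>auto simp: R_def E\<close>)
  have "?D s = R s" if "s \<in> S - {a}" for s
    unfolding fG'[OF that] Ha[symmetric] stieltjes1_eq[OF E zeta_E, simplified]
    by (simp add: G_def R_def algebra_simps)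
  then have ev: "\<forall>\<^sub>F s in at a. ?D s = R s"
    using eventually_at_in_open[OF S(1,2)] by (auto elim!: eventually_mono)
  with R show D: "?D \<in> O[at a](\<lambda>s. s - a)" by (simp cong: landau_o.big.in_cong)
  have "((\<lambda>s. s - a) \<longlongrightarrow> a - a) (at a)" by (intro tendsto_intros)
  then have D0: "(?D \<longlongrightarrow> 0) (at a)" using bigo_imp_tendsto_0[OF D] by simp
  define c where "c = (A * euler_mascheroni + B * stieltjes1 + (\<Sum>\<^sub>\<infinity>m\<in>{1..}. b m * of_nat m ^ t / of_nat m))"
  \<comment> \<open>The limit of f(s) (s-a)^k is the leading coefficient: A with k = 1 if B = 0, and
    B with k = 2 otherwise.\<close>
  show "is_pole f a" if "A \<noteq> 0 \<or> B \<noteq> 0"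
  proof (cases "B = 0")
    case True
    have "((\<lambda>s. A + c * (s - a) + ?D s * (s - a)) \<longlongrightarrow> A + c * (a - a) + 0 * (a - a)) (at a)"
      by (intro tendsto_intros D0)
    moreover have "\<forall>\<^sub>F s in at a. A + c * (s - a) + ?D s * (s - a) = f s * (s - a) ^ 1"
      by (auto simp: eventually_at_filter True c_def divide_simps)
    ultimately have "((\<lambda>s. f s * (s - a) ^ 1) \<longlongrightarrow> A + c * (a - a) + 0 * (a - a)) (at a)"
      by (rule Lim_transform_eventually)
    then have "((\<lambda>s. f s * (s - a) ^ 1) \<longlongrightarrow> A) (at a)" by simp
    then show ?thesis by (rule is_pole_of_tendsto) (use True that in auto)
  next
    case False
    have "((\<lambda>s. B + A * (s - a) + c * (s - a)\<^sup>2 + ?D s * (s - a)\<^sup>2) \<longlongrightarrow>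
            B + A * (a - a) + c * (a - a)\<^sup>2 + 0 * (a - a)\<^sup>2) (at a)"
      by (intro tendsto_intros D0)
    moreover have "\<forall>\<^sub>F s in at a. B + A * (s - a) + c * (s - a)\<^sup>2 + ?D s * (s - a)\<^sup>2 = f s * (s - a) ^ 2"
      by (auto simp: eventually_at_filter c_def divide_simps) (simp add: algebra_simps power2_eq_square)
    ultimately have "((\<lambda>s. f s * (s - a) ^ 2) \<longlongrightarrow> B + A * (a - a) + c * (a - a)\<^sup>2 + 0 * (a - a)\<^sup>2) (at a)"
      by (rule Lim_transform_eventually)
    then have "((\<lambda>s. f s * (s - a) ^ 2) \<longlongrightarrow> B) (at a)" by simp
    then show ?thesis by (rule is_pole_of_tendsto) (use False in auto)
  qed
qed

section \<open>Polygamma asymptotics and partial fractions\<close>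

text \<open>Since p - q = p q, the difference p^k - q^k is p q times a sum of k products between
  q^(k-1) and p^(k-1). In use p = 1/(y+n) and q = 1/(y+n+1), and the lemma is a discrete comparison
  of a sum with an integral.\<close>

lemma inverse_power_diff_bounds:
  fixes p q :: real
  assumes "0 \<le> q" "q \<le> p" "p - q = p * q"
  shows "real k * q ^ (k + 1) \<le> p ^ k - q ^ k" "p ^ k - q ^ k \<le> real k * p ^ (k + 1)"
proof -
  have eq: "p ^ k - q ^ k = p * q * (\<Sum>i<k. q ^ (k - Suc i) * p ^ i)"
    using power_diff_sumr2[of p k q] assms(3) by simp
  have bd: "q ^ (k - 1) \<le> q ^ (k - Suc i) * p ^ i" "q ^ (k - Suc i) * p ^ i \<le> p ^ (k - 1)"
    if "i \<in> {..<k}" for i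
  proof -
    have *: "k - 1 = (k - Suc i) + i" using that by auto
    show "q ^ (k - 1) \<le> q ^ (k - Suc i) * p ^ i" "q ^ (k - Suc i) * p ^ i \<le> p ^ (k - 1)"
      using assms unfolding * power_add by (auto intro!: mult_mono power_mono)
  qed
  have "real k * q ^ (k + 1) = q * q * (\<Sum>i<k. q ^ (k - 1))"
    by (cases k) (auto simp: algebra_simps)
  also have "\<dots> \<le> p * q * (\<Sum>i<k. q ^ (k - Suc i) * p ^ i)"
    using assms by (intro mult_mono sum_mono bd) (auto intro!: sum_nonneg)
  finally show "real k * q ^ (k + 1) \<le> p ^ k - q ^ k" using eq by simp
  have "p * q * (\<Sum>i<k. q ^ (k - Suc i) * p ^ i) \<le> p * p * (\<Sum>i<k. p ^ (k - 1))"
    using assms by (intro mult_mono sum_mono bd) (auto intro!: sum_nonneg)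
  also have "\<dots> = real k * p ^ (k + 1)"
    by (cases k) (auto simp: algebra_simps)
  finally show "p ^ k - q ^ k \<le> real k * p ^ (k + 1)" using eq by simp
qed

text \<open>With p_n = 1/(y+n), \<open>Polygamma k y\<close> is (-1)^(k+1) k! times the sum of
  p_n^(k+1). Subtracting (p_n^k - p_(n+1)^k)/k, which telescopes to y^-k / k, leaves terms between 0
  and p_n^(k+1) - p_(n+1)^(k+1); the latter telescope to y^-(k+1).\<close>

lemma Polygamma_real_asymp:
  fixes y :: real
  assumes y: "y > 0" and k: "k \<ge> 1"
  shows "\<bar>Polygamma k y + (-1) ^ k * fact (k - 1) / y ^ k\<bar> \<le> fact k / y ^ (k + 1)"
proof -
  have tel: "(\<lambda>n. inverse (y + real n) ^ j - inverse (y + real (Suc n)) ^ j) sums (inverse (y + real 0) ^ j - 0)"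
    if "j > 0" for j
  proof (rule telescope_sums')
    have "(\<lambda>n. inverse (y + real n)) \<longlonglongrightarrow> 0"
      by (intro tendsto_inverse_0_at_top filterlim_tendsto_add_at_top[OF tendsto_const] filterlim_real_sequentially)
    then have "(\<lambda>n. inverse (y + real n) ^ j) \<longlonglongrightarrow> 0 ^ j" by (intro tendsto_intros)
    then show "(\<lambda>n. inverse (y + real n) ^ j) \<longlonglongrightarrow> 0" using that by (simp add: power_0_left)
  qed
  have P: "(\<lambda>n. inverse (y + real n) ^ (k + 1)) sums ((-1) ^ Suc k * Polygamma k y / fact k)"
    using Polygamma_LIMSEQ[of y k] y k by (simp add: power_inverse)
  let ?d = "\<lambda>n. inverse (y + real n) ^ (k + 1) - (inverse (y + real n) ^ k - inverse (y + real (Suc n)) ^ k) / real k"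
  have D: "?d sums ((-1) ^ Suc k * Polygamma k y / fact k - (inverse (y + real 0) ^ k - 0) / real k)"
    by (intro sums_diff P sums_divide tel) (use k in auto)
  have 1: "real k * inverse (y + real (Suc n)) ^ (k + 1) \<le> inverse (y + real n) ^ k - inverse (y + real (Suc n)) ^ k"
    "inverse (y + real n) ^ k - inverse (y + real (Suc n)) ^ k \<le> real k * inverse (y + real n) ^ (k + 1)" for n
    using inverse_power_diff_bounds[of "inverse (y + real (Suc n))" "inverse (y + real n)" k] y
    by (auto simp: field_simps)
  have "0 \<le> (-1) ^ Suc k * Polygamma k y / fact k - (inverse (y + real 0) ^ k - 0) / real k"
    by (rule sums_le[OF _ sums_zero D]) (use 1 k in \<open>auto simp: field_simps\<close>)
  moreover have "(-1) ^ Suc k * Polygamma k y / fact k - (inverse (y + real 0) ^ k - 0) / real k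
      \<le> inverse (y + real 0) ^ (k + 1) - 0"
    by (rule sums_le[OF _ D tel]) (use 1 k in \<open>auto simp: field_simps\<close>)
  ultimately have *: "\<bar>(-1) ^ Suc k * Polygamma k y / fact k - inverse y ^ k / real k\<bar> \<le> inverse y ^ (k + 1)"
    by simp
  have fk: "fact k = real k * fact (k - 1)" using k by (cases k) auto
  have "Polygamma k y + (-1) ^ k * fact (k - 1) / y ^ k =
     (-1) ^ Suc k * fact k * ((-1) ^ Suc k * Polygamma k y / fact k - inverse y ^ k / real k)"
  proof -
    have "(-1) ^ Suc k * (-1) ^ Suc k = (1 :: real)" by (simp flip: power_mult_distrib)
    then have "(-1) ^ Suc k * fact k * ((-1) ^ Suc k * Polygamma k y / fact k - W) =
        Polygamma k y + (-1) ^ k * (fact k * W)" for W :: real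
      by (simp add: algebra_simps)
    moreover have "fact k * (inverse y ^ k / real k) = fact (k - 1) / y ^ k"
      unfolding fk using k y by (simp add: field_simps power_inverse)
    ultimately show ?thesis by simp
  qed
  then have "\<bar>Polygamma k y + (-1) ^ k * fact (k - 1) / y ^ k\<bar> =
     fact k * \<bar>(-1) ^ Suc k * Polygamma k y / fact k - inverse y ^ k / real k\<bar>"
    by (simp add: abs_mult)
  also have "\<dots> \<le> fact k * inverse y ^ (k + 1)" by (intro mult_left_mono *) auto
  finally show ?thesis by (simp add: divide_inverse power_inverse)
qed

text \<open>By the mean value theorem for \<open>ln_Gamma\<close>, \<open>ln y\<close> is a value of the digamma function on \<open>(y, y+1)\<close>.\<close>

lemma Digamma_real_asymp:
  fixes y :: real
  assumes y: "y > 0"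
  shows "\<bar>Digamma y - ln y\<bar> \<le> 1 / y"
proof -
  have "\<exists>z>y. z < y + 1 \<and> ln_Gamma (y + 1) - ln_Gamma y = (y + 1 - y) * Digamma z"
    by (rule MVT2) (use y in \<open>auto intro!: derivative_intros\<close>)
  then obtain z where z: "y < z" "z < y + 1" "ln_Gamma (y + 1) - ln_Gamma y = Digamma z" by auto
  have "exp (ln_Gamma (y + 1)) = y * exp (ln_Gamma y)"
    using Gamma_plus1[of y] y by (simp add: Gamma_real_pos_exp nonpos_Ints_def)
  then have "exp (ln_Gamma (y + 1)) = exp (ln y + ln_Gamma y)" using y by (simp add: exp_add)
  then have "Digamma z = ln y" using z(3) by simp
  moreover have "Digamma y \<le> Digamma z" "Digamma z \<le> Digamma (y + 1)"
    using Digamma_real_mono[of y z] Digamma_real_mono[of z "y + 1"] y z by auto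
  moreover have "Digamma (y + 1) = Digamma y + 1 / y" using Digamma_plus1[of y] y by simp
  ultimately show ?thesis by linarith
qed

text \<open>
  With \<open>p = 1/a\<close>, \<open>q = 1/(a+y)\<close> and \<open>z = 1/y\<close> one has \<open>p q = z (p - q)\<close>, and \<open>pfrac r t p z\<close> is the part of the
  partial fraction decomposition of \<open>p\<^sup>r q\<^sup>t\<close> in powers of \<open>p\<close>; exchanging the roles of \<open>p\<close> and \<open>q\<close> replaces
  \<open>z\<close> by \<open>-z\<close>. The truncated \<open>t + i - 1\<close> makes the binomial coefficient \<open>1\<close> for \<open>t = i = 0\<close>, as needed.
\<close>

definition pfrac :: "nat \<Rightarrow> nat \<Rightarrow> 'a::comm_ring_1 \<Rightarrow> 'a \<Rightarrow> 'a" where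
  "pfrac r t p z = (\<Sum>i<r. (-1) ^ i * of_nat ((t + i - 1) choose i) * z ^ (t + i) * p ^ (r - i))"

text \<open>Pascal's rule for the coefficients. It matches the recursion of p^r q^t: replacing one
  factor p q by z (p - q) lowers one exponent at a time.\<close>

lemma pfrac_Suc_Suc: "pfrac (Suc r) (Suc t) p z = z * (pfrac (Suc r) t p z - pfrac r (Suc t) p z)"
proof -
  have "pfrac (Suc r) (Suc t) p z = z ^ Suc t * p ^ Suc r +
     (\<Sum>i<r. (-1) ^ Suc i * of_nat ((t + Suc i) choose Suc i) * z ^ (Suc t + Suc i) * p ^ (r - i))"
    unfolding pfrac_def by (subst sum.lessThan_Suc_shift) simp
  moreover have "pfrac (Suc r) t p z = z ^ t * p ^ Suc r +
     (\<Sum>i<r. (-1) ^ Suc i * of_nat ((t + i) choose Suc i) * z ^ (t + Suc i) * p ^ (r - i))"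
    unfolding pfrac_def by (subst sum.lessThan_Suc_shift) simp
  moreover have "(\<Sum>i<r. (-1) ^ Suc i * of_nat ((t + Suc i) choose Suc i) * z ^ (Suc t + Suc i) * p ^ (r - i)) =
     z * ((\<Sum>i<r. (-1) ^ Suc i * of_nat ((t + i) choose Suc i) * z ^ (t + Suc i) * p ^ (r - i)) - pfrac r (Suc t) p z)"
    unfolding pfrac_def sum_subtractf[symmetric] sum_distrib_left
    by (rule sum.cong) (simp_all add: algebra_simps)
  ultimately show ?thesis by (simp add: algebra_simps)
qed

text \<open>Both sides obey the same recursion, since the hypothesis is unchanged when p and q are
  exchanged and z becomes -z. If r or t is 0, one summand is 0 and the other reduces to a single
  power; for r = t = 0 both summands would be 0 while the left side is 1.\<close>

lemma partial_fractions:
  assumes pq: "p * q = z * (p - q)" and "r + t > 0"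
  shows "p ^ r * q ^ t = pfrac r t p z + pfrac t r q (- z)"
  using assms(2)
proof (induction "r + t" arbitrary: r t rule: less_induct)
  case less
  have t0: "pfrac (Suc r) 0 p z = p ^ Suc r" for r p z
    unfolding pfrac_def by (subst sum.lessThan_Suc_shift) (simp add: binomial_eq_0)
  have z0: "pfrac 0 t p z = 0" for t p z by (simp add: pfrac_def)
  show ?case
  proof (cases r)
    case 0
    then show ?thesis using less.prems by (cases t) (simp_all add: t0 z0)
  next
    case (Suc r')
    show ?thesis
    proof (cases t)
      case 0
      then show ?thesis using Suc by (simp add: t0 z0)
    next
      case (Suc t')
      have "p ^ r * q ^ t = p ^ r' * q ^ t' * (p * q)"
        using \<open>r = Suc r'\<close> Suc by (simp add: algebra_simps)
      also have "\<dots> = z * (p ^ r * q ^ t' - p ^ r' * q ^ t)"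
        unfolding pq using \<open>r = Suc r'\<close> Suc by (simp add: algebra_simps)
      also have "p ^ r * q ^ t' = pfrac r t' p z + pfrac t' r q (- z)"
        by (rule less.hyps) (use \<open>r = Suc r'\<close> Suc in auto)
      also have "p ^ r' * q ^ t = pfrac r' t p z + pfrac t r' q (- z)"
        by (rule less.hyps) (use \<open>r = Suc r'\<close> Suc in auto)
      finally show ?thesis
        unfolding \<open>r = Suc r'\<close> Suc pfrac_Suc_Suc by (simp add: algebra_simps)
    qed
  qed
qed

text \<open>Powers of 1/n and 1/(n+y) with exponent at least 2 sum separately to zeta and polygamma
  values. The first powers do not, but their coefficients are opposite, and the series of the
  differences is \<gamma> + \<psi>(y+1).\<close>

lemma MT_inner_sum:
  fixes y :: complex
  assumes y: "y \<notin> \<int>\<^sub>\<le>\<^sub>0" and r: "r \<ge> 1" and t: "t \<ge> 1"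
  shows "(\<lambda>n. 1 / (of_nat (Suc n) ^ r * (of_nat (Suc n) + y) ^ t)) sums
     ((\<Sum>i<r - 1. (-1) ^ i * of_nat ((t + i - 1) choose i) / y ^ (t + i) * zeta (of_nat (r - i)))
      + (-1) ^ r * (\<Sum>j<t - 1. of_nat ((r + j - 1) choose j) * ((-1) ^ (t - j) / fact (t - j - 1))
            / y ^ (r + j) * Polygamma (t - j - 1) (y + 1))
      - (-1) ^ r * of_nat ((r + t - 2) choose (t - 1)) / y ^ (r + t - 1) * (euler_mascheroni + Digamma (y + 1)))"
proof -
  define p where "p = (\<lambda>n. inverse (of_nat (Suc n)) :: complex)"
  define q where "q = (\<lambda>n. inverse (y + 1 + of_nat n))"
  define z where "z = inverse y"
  have y0: "y \<noteq> 0" using y by auto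
  have y1: "y + 1 + of_nat n \<noteq> 0" for n
    using y plus_of_nat_eq_0_imp[of y "Suc n"] by (auto simp: add_ac)
  have pq: "p n * q n = z * (p n - q n)" for n
    using y0 y1[of n] of_nat_neq_0[of n, where ?'a = complex]
    unfolding p_def q_def z_def by (simp add: field_simps)
  have pz: "(\<lambda>n. p n ^ k) sums zeta (of_nat k)" if "k \<ge> 2" for k
    using zeta_of_nat_sums[OF that] by (simp add: p_def)
  have qP: "(\<lambda>n. q n ^ k) sums ((-1) ^ k * Polygamma (k - 1) (y + 1) / fact (k - 1))" if "k \<ge> 2" for k
    using Polygamma_LIMSEQ[of "y + 1" "k - 1"] y1[of 0] that by (simp add: q_def power_inverse)
  have pqD: "(\<lambda>n. p n - q n) sums (euler_mascheroni + Digamma (y + 1))"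
    using summable_sums[OF summable_Digamma[of "y + 1"]] y1[of 0]
    by (simp add: p_def q_def Digamma_def)
  have decomp: "1 / (of_nat (Suc n) ^ r * (of_nat (Suc n) + y) ^ t) =
     (\<Sum>i<r - 1. (-1) ^ i * of_nat ((t + i - 1) choose i) / y ^ (t + i) * p n ^ (r - i))
      + (-1) ^ r * (\<Sum>j<t - 1. of_nat ((r + j - 1) choose j) / y ^ (r + j) * q n ^ (t - j))
      - (-1) ^ r * of_nat ((r + t - 2) choose (t - 1)) / y ^ (r + t - 1) * (p n - q n)" for n
  proof -
    have alg: "X - c * u + (Y + c * v) = X + Y - c * (u - v)" for X Y c u v :: complex
      by (simp add: algebra_simps)
    obtain r' t' where rt: "r = Suc r'" "t = Suc t'" using r t by (cases r; cases t) auto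
    have "1 / (of_nat (Suc n) ^ r * (of_nat (Suc n) + y) ^ t) = p n ^ r * q n ^ t"
      by (simp add: p_def q_def power_inverse divide_inverse add_ac del: of_nat_Suc) (simp add: add_ac)
    also have "\<dots> = pfrac r t (p n) z + pfrac t r (q n) (- z)"
      by (rule partial_fractions[OF pq]) (use r in auto)
    \<comment> \<open>The term i = r - 1 carries the first power of p; symmetry of the binomial
      coefficient brings its coefficient to the form of the one belonging to q.\<close>
    also have "pfrac r t (p n) z =
       (\<Sum>i<r - 1. (-1) ^ i * of_nat ((t + i - 1) choose i) / y ^ (t + i) * p n ^ (r - i))
       - (-1) ^ r * of_nat ((r + t - 2) choose (t - 1)) / y ^ (r + t - 1) * p n"
      using binomial_symmetric[of r' "r' + t'"]
      by (simp add: pfrac_def rt z_def divide_inverse power_inverse add_ac)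
    also have "pfrac t r (q n) (- z) =
       (-1) ^ r * (\<Sum>j<t - 1. of_nat ((r + j - 1) choose j) / y ^ (r + j) * q n ^ (t - j))
       + (-1) ^ r * of_nat ((r + t - 2) choose (t - 1)) / y ^ (r + t - 1) * q n"
    proof -
      have sgn: "(-1) ^ j * (- z) ^ (r + j) = (-1) ^ r * inverse (y ^ (r + j))" for j
        by (simp add: z_def power_minus[of "inverse y"] power_add power_inverse mult.assoc
             flip: power_mult_distrib)
      have c: "(-1) ^ j * of_nat ((r + j - 1) choose j) * (- z) ^ (r + j) * q n ^ (t - j) =
         (-1) ^ r * (of_nat ((r + j - 1) choose j) / y ^ (r + j) * q n ^ (t - j))" for j
        using sgn[of j] by (simp add: divide_inverse mult_ac)
      show ?thesis
        unfolding pfrac_def c sum_distrib_left[symmetric] unfolding rt diff_Suc_1 sum.lessThan_Suc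
        by (simp add: algebra_simps)
    qed
    finally show ?thesis unfolding alg .
  qed
  have "(\<lambda>n. 1 / (of_nat (Suc n) ^ r * (of_nat (Suc n) + y) ^ t)) sums
     ((\<Sum>i<r - 1. (-1) ^ i * of_nat ((t + i - 1) choose i) / y ^ (t + i) * zeta (of_nat (r - i)))
      + (-1) ^ r * (\<Sum>j<t - 1. of_nat ((r + j - 1) choose j) / y ^ (r + j) *
          ((-1) ^ (t - j) * Polygamma (t - j - 1) (y + 1) / fact (t - j - 1)))
      - (-1) ^ r * of_nat ((r + t - 2) choose (t - 1)) / y ^ (r + t - 1) * (euler_mascheroni + Digamma (y + 1)))"
    unfolding decomp by (intro sums_add sums_diff sums_mult sums_sum pqD pz qP) auto
  also have "(\<Sum>j<t - 1. of_nat ((r + j - 1) choose j) / y ^ (r + j) *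
          ((-1) ^ (t - j) * Polygamma (t - j - 1) (y + 1) / fact (t - j - 1))) =
     (\<Sum>j<t - 1. of_nat ((r + j - 1) choose j) * ((-1) ^ (t - j) / fact (t - j - 1))
            / y ^ (r + j) * Polygamma (t - j - 1) (y + 1))"
    by (intro sum.cong) (auto simp: mult_ac)
  finally show ?thesis .
qed

section \<open>The Mordell--Tornheim series as a Dirichlet series\<close>

definition MT_inner :: "real \<Rightarrow> nat \<Rightarrow> nat \<Rightarrow> nat \<Rightarrow> complex" where
  "MT_inner x r t m = (\<Sum>\<^sub>\<infinity>n\<in>{1::nat..}. 1 / (of_nat n ^ r * (of_nat n + of_nat m * of_real x) ^ t))"

text \<open>The bound is uniform in m, because n + m x \<ge> n. Hence n^-2 m^(-Re s) is a product
  majorant for the double series.\<close>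

lemma MT_term_norm_le:
  assumes x: "x > 0" and rt: "r + t \<ge> 2" and n: "n \<ge> 1"
  shows "norm (1 / (of_nat n ^ r * (of_nat n + of_nat m * of_real x) ^ t) :: complex) \<le> real n powr - 2"
proof -
  have mx: "real m * x \<ge> 0" using x by simp
  have "of_nat n + of_nat m * of_real x = (of_real (real n + real m * x) :: complex)" by simp
  then have "norm (of_nat n + of_nat m * of_real x :: complex) = real n + real m * x"
    using mx n by (simp only: norm_of_real)
  then have eq: "norm (1 / (of_nat n ^ r * (of_nat n + of_nat m * of_real x) ^ t) :: complex) =
     1 / (real n ^ r * (real n + real m * x) ^ t)"
    by (simp add: norm_divide norm_mult norm_power)
  have "real n ^ 2 \<le> real n ^ (r + t)" using n rt by (intro power_increasing) auto
  also have "\<dots> \<le> real n ^ r * (real n + real m * x) ^ t"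
    unfolding power_add using mx by (intro mult_left_mono power_mono) auto
  finally have "1 / (real n ^ r * (real n + real m * x) ^ t) \<le> 1 / real n ^ 2"
    using n by (intro divide_left_mono) (auto intro!: mult_pos_pos zero_less_power add_pos_nonneg mx)
  also have "1 / real n ^ 2 = real n powr - 2"
    using n by (simp add: powr_minus divide_inverse)
  finally show ?thesis unfolding eq .
qed

lemma powr_summable_on: "e > 1 \<Longrightarrow> (\<lambda>n::nat. real n powr - e) summable_on {1..}"
  using infsum_atLeast_1_eq_suminf(1)[of "\<lambda>n. real n powr - e"] by (simp add: summable_real_powr_iff)

lemma MT_inner_sums:
  assumes x: "x > 0" and rt: "r + t \<ge> 2"
  shows "(\<lambda>n. 1 / (of_nat (Suc n) ^ r * (of_nat (Suc n) + of_nat m * of_real x) ^ t)) sums MT_inner x r t m"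
proof -
  have "(\<lambda>n. norm (1 / (of_nat n ^ r * (of_nat n + of_nat m * of_real x) ^ t) :: complex)) summable_on {1..}"
    by (rule Infinite_Sum.abs_summable_on_comparison_test'[OF powr_summable_on[of 2]])
       (use MT_term_norm_le[OF x rt] in auto)
  from summable_on_atLeast_1_sums[OF abs_summable_summable[OF this]]
  show ?thesis unfolding MT_inner_def .
qed

text \<open>In \<open>MT_series\<close> the sum over m is inside, whereas the Dirichlet series has
  it outside; the product majorant justifies the exchange. A right half-plane suffices as starting
  point for the identity theorem.\<close>

lemma MT_series_eq:
  assumes x: "x > 0" and rt: "r + t \<ge> 2" and s: "Re s > 2"
  shows "(\<lambda>m. MT_inner x r t (Suc m) * of_nat (Suc m) powr - s) sums MT_series x (of_nat r, s, of_nat t)"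
proof -
  define g where "g = (\<lambda>n m. 1 / (of_nat n ^ r * (of_nat n + of_nat m * of_real x) ^ t) * of_nat m powr - s :: complex)"
  have "(\<lambda>(n, m). real n powr - 2 * real m powr - Re s) summable_on {1..} \<times> {1..}"
  proof (rule summable_on_SigmaI)
    show "((\<lambda>m. case (n, m) of (n, m) \<Rightarrow> real n powr - 2 * real m powr - Re s) has_sum
        real n powr - 2 * (\<Sum>\<^sub>\<infinity>m\<in>{1::nat..}. real m powr - Re s)) {1..}" for n :: nat
      using powr_summable_on[of "Re s"] s by (auto intro!: has_sum_cmult_right)
    show "(\<lambda>n. real n powr - 2 * (\<Sum>\<^sub>\<infinity>m\<in>{1::nat..}. real m powr - Re s)) summable_on {1::nat..}"
      by (intro summable_on_cmult_left powr_summable_on) auto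
  qed auto
  then have "(\<lambda>z. norm (case z of (n, m) \<Rightarrow> g n m)) summable_on {1..} \<times> {1..}"
  proof (rule Infinite_Sum.abs_summable_on_comparison_test')
    fix z :: "nat \<times> nat" assume "z \<in> {1..} \<times> {1..}"
    then obtain n m where z: "z = (n, m)" "n \<ge> 1" "m \<ge> 1" by auto
    show "norm (case z of (n, m) \<Rightarrow> g n m) \<le> (case z of (n, m) \<Rightarrow> real n powr - 2 * real m powr - Re s)"
      unfolding z(1) prod.case g_def norm_mult using z(2,3)
      by (intro mult_mono MT_term_norm_le[OF x rt]) (auto simp: norm_of_nat_powr)
  qed
  then have summ: "(\<lambda>(n, m). g n m) summable_on {1..} \<times> {1..}" by (rule abs_summable_summable)
  have inner: "(\<Sum>\<^sub>\<infinity>n\<in>{1..}. g n m) = MT_inner x r t m * of_nat m powr - s" for m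
    unfolding g_def MT_inner_def by (rule infsum_cmult_left')
  have "MT_series x (of_nat r, s, of_nat t) = (\<Sum>\<^sub>\<infinity>n\<in>{1..}. \<Sum>\<^sub>\<infinity>m\<in>{1..}. g n m)"
    unfolding MT_series_def prod.case
  proof (intro infsum_cong)
    fix n m :: nat assume nm: "n \<in> {1..}" "m \<in> {1..}"
    \<comment> \<open>The base must be nonzero to replace \<open>powr\<close> by a natural power:
      for exponent 0, hence for t = 0, the two differ at base 0.\<close>
    have "of_nat n + of_nat m * of_real x = (of_real (real n + real m * x) :: complex)" by simp
    moreover have "real n + real m * x > 0" using nm x by (intro add_pos_pos) auto
    ultimately have "of_nat n + of_nat m * of_real x \<noteq> (0 :: complex)" by (metis less_irrefl of_real_eq_0_iff)
    then show "1 / (of_nat n powr of_nat r * of_nat m powr s * (of_nat n + of_nat m * of_real x) powr of_nat t) = g n m"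
      using nm by (simp add: g_def powr_nat powr_minus field_simps)
  qed
  also have "\<dots> = (\<Sum>\<^sub>\<infinity>m\<in>{1..}. \<Sum>\<^sub>\<infinity>n\<in>{1..}. g n m)" by (rule infsum_swap_banach[OF summ])
  also have "\<dots> = (\<Sum>\<^sub>\<infinity>m\<in>{1..}. MT_inner x r t m * of_nat m powr - s)"
    unfolding inner ..
  finally have eq: "MT_series x (of_nat r, s, of_nat t) = (\<Sum>\<^sub>\<infinity>m\<in>{1..}. MT_inner x r t m * of_nat m powr - s)" .
  have "(\<lambda>(m, n). g n m) summable_on {1..} \<times> {1..}"
    using summ by (subst summable_on_swap) simp
  then have "(\<lambda>m. \<Sum>\<^sub>\<infinity>n\<in>{1..}. g n m) summable_on {1..}" by (rule summable_on_Sigma_banach)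
  then have "(\<lambda>m. MT_inner x r t m * of_nat m powr - s) summable_on {1..}"
    unfolding inner .
  from summable_on_atLeast_1_sums[OF this] show ?thesis unfolding eq .
qed

text \<open>On this line r + t = 1 - l is excluded by r + t \<ge> 2, and Re s > -t leaves only l = 0
  in s + t = 1 - l. The hyperplane r + s + t = 2 meets the half-plane only for r = 1, in the same
  point s = 1 - t, in accordance with the double pole.\<close>

lemma MT_slice:
  assumes x: "x > 0" and mt: "is_MT_zeta x \<Theta>" and r: "r \<ge> 1" and rt: "r + t \<ge> 2"
  shows "(\<lambda>s. \<Theta> (of_nat r, s, of_nat t)) holomorphic_on {s. Re s > - real t} - {1 - of_nat t}"
    and "Re s > 2 \<Longrightarrow> (\<lambda>m. MT_inner x r t (Suc m) * of_nat (Suc m) powr - s) sums \<Theta> (of_nat r, s, of_nat t)"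
proof -
  have hol: "holomorphic3_on \<Theta> (- MT_singular_hyperplanes)"
    and eq: "\<And>p. p \<in> MT_convergence_region \<Longrightarrow> \<Theta> p = MT_series x p"
    using mt unfolding is_MT_zeta_def meromorphic3_off_def by auto
  let ?S = "{s. Re s > - real t} - {1 - of_nat t}"
  have opn: "open ?S" by (intro open_Diff open_halfspace_Re_gt) auto
  show "(\<lambda>s. \<Theta> (of_nat r, s, of_nat t)) holomorphic_on ?S"
    unfolding holomorphic_on_open[OF opn]
  proof
    fix s assume s: "s \<in> ?S"
    have "(of_nat r, s, of_nat t) \<notin> MT_singular_hyperplanes"
    proof
      assume "(of_nat r, s, of_nat t) \<in> MT_singular_hyperplanes"
      then consider l where "of_nat r + of_nat t = (1 - of_nat l :: complex)"
        | l where "s + of_nat t = 1 - of_nat l" | "of_nat r + s + of_nat t = 2"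
        by (auto simp: MT_singular_hyperplanes_def)
      then show False
      proof cases
        case 1
        from arg_cong[OF 1, of Re] rt show False by simp
      next
        case 2
        from arg_cong[OF 2, of Re] s have "real l < 1" by simp
        with 2 s show False by (auto simp: algebra_simps)
      next
        case 3
        from arg_cong[OF 3, of Re] s have "real r < 2" by simp
        with r have "r = 1" by simp
        with 3 s show False by (auto simp: algebra_simps)
      qed
    qed
    then obtain a b c where "(\<Theta> has_derivative (\<lambda>(u, v, w). a * u + b * v + c * w)) (at (of_nat r, s, of_nat t))"
      using hol unfolding holomorphic3_on_def by blast
    moreover have "((\<lambda>s. (of_nat r, s, of_nat t)) has_derivative (\<lambda>h. (0, h, 0))) (at s)"
      by (auto intro!: derivative_eq_intros)
    ultimately have "((\<lambda>s. \<Theta> (of_nat r, s, of_nat t)) has_derivative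
        (\<lambda>h. (\<lambda>(u, v, w). a * u + b * v + c * w) (0, h, 0))) (at s)"
      by (rule has_derivative_compose[rotated])
    then show "\<exists>f'. ((\<lambda>s. \<Theta> (of_nat r, s, of_nat t)) has_field_derivative f') (at s)"
      by (auto simp: has_field_derivative_def)
  qed
  show "(\<lambda>m. MT_inner x r t (Suc m) * of_nat (Suc m) powr - s) sums \<Theta> (of_nat r, s, of_nat t)" if "Re s > 2"
  proof -
    have "real r + real t \<ge> 2" using rt by linarith
    then have "(of_nat r, s, of_nat t) \<in> MT_convergence_region"
      using that by (simp add: MT_convergence_region_def)
    then show ?thesis using MT_series_eq[OF x rt that] eq by simp
  qed
qed

section \<open>Remainders of the inner sums\<close>

text \<open>Landau symbols compare functions of one type, so the real powers are embedded into the
  complex numbers; bounds then multiply by adding exponents.\<close>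

abbreviation cpowr :: "real \<Rightarrow> nat \<Rightarrow> complex" where
  "cpowr e \<equiv> (\<lambda>m. of_real (real m powr e))"

lemma bigo_cong_imp: "f \<in> O[F](h) \<Longrightarrow> \<forall>\<^sub>F x in F. f x = g x \<Longrightarrow> g \<in> O[F](h)"
  by (simp cong: landau_o.big.in_cong)

lemma bigo_cpowr_mult: "f \<in> O(cpowr a) \<Longrightarrow> g \<in> O(cpowr b) \<Longrightarrow> (\<lambda>m. f m * g m) \<in> O(cpowr (a + b))"
  using landau_o.big.mult[of f sequentially "cpowr a" g "cpowr b"] by (simp add: powr_add)

lemma bigo_cpowr_mono: "f \<in> O(cpowr a) \<Longrightarrow> a \<le> b \<Longrightarrow> f \<in> O(cpowr b)"
proof (erule landau_o.big_trans)
  assume "a \<le> b"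
  then show "cpowr a \<in> O(cpowr b)"
    by (intro bigoI[where c = 1] eventually_mono[OF eventually_ge_at_top[of 1]]) (auto intro: powr_mono)
qed

lemma bigo_cpowr_const: "(\<lambda>_. c) \<in> O(cpowr 0)"
  by (rule bigoI[where c = "norm c"], use eventually_ge_at_top[of 1] in eventually_elim) auto

lemma bigo_cpowr_cmult: "f \<in> O(cpowr a) \<Longrightarrow> (\<lambda>m. c * f m) \<in> O(cpowr a)"
  using bigo_cpowr_mult[OF bigo_cpowr_const] by simp

lemma bigo_cpowr_power_divide:
  "x \<noteq> 0 \<Longrightarrow> (\<lambda>m. 1 / (of_nat m * of_real x) ^ k) \<in> O(cpowr (- real k))"
  by (rule bigoI[where c = "1 / \<bar>x\<bar> ^ k"], use eventually_ge_at_top[of 1] in eventually_elim)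
     (simp add: norm_divide norm_mult norm_power power_mult_distrib powr_minus powr_realpow divide_inverse norm_inverse)

lemma bigo_cpowr_powi: "(\<lambda>m. 1 / of_nat m powi k) \<in> O(cpowr (- real_of_int k))"
  by (rule bigoI[where c = 1], use eventually_ge_at_top[of 1] in eventually_elim)
     (simp add: norm_divide norm_power_int powr_minus powr_real_of_int' divide_inverse norm_inverse)

section \<open>Growth of polygamma functions along the multiples of x\<close>

lemma Polygamma_bigo:
  assumes x: "x > 0" and k: "k \<ge> 1"
  shows "(\<lambda>m. Polygamma k (of_nat m * of_real x) + (-1) ^ k * fact (k - 1) / (of_nat m * of_real x) ^ k)
           \<in> O(cpowr (- real (k + 1)))"
proof (rule bigoI[where c = "fact k / x ^ (k + 1)"], use eventually_ge_at_top[of 1] in eventually_elim)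
  case (elim m)
  define y where "y = real m * x"
  have y: "y > 0" using elim x by (simp add: y_def)
  have my: "of_nat m * of_real x = complex_of_real y" by (simp add: y_def)
  have "Polygamma k (of_nat m * of_real x) + (-1) ^ k * fact (k - 1) / (of_nat m * of_real x) ^ k =
     complex_of_real (Polygamma k y + (-1) ^ k * fact (k - 1) / y ^ k)"
    unfolding my using y by (simp add: Polygamma_of_real)
  then have "norm (Polygamma k (of_nat m * of_real x) + (-1) ^ k * fact (k - 1) / (of_nat m * of_real x) ^ k :: complex)
     \<le> fact k / y ^ (k + 1)"
    using Polygamma_real_asymp[OF y k] by (simp only: norm_of_real)
  also have "fact k / y ^ (k + 1) = fact k / x ^ (k + 1) * norm (cpowr (- real (k + 1)) m)"
    using elim powr_realpow[of "real m" "k + 1"] powr_minus[of "real m" "real (k + 1)"] unfolding norm_of_real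
    by (simp add: y_def power_mult_distrib powr_minus divide_inverse)
  finally show ?case .
qed

lemma Digamma_bigo:
  assumes x: "x > 0"
  shows "(\<lambda>m. Digamma (of_nat m * of_real x) - of_real (ln (real m * x))) \<in> O(cpowr (- 1))"
proof (rule bigoI[where c = "1 / x"], use eventually_ge_at_top[of 1] in eventually_elim)
  case (elim m)
  define y where "y = real m * x"
  have y: "y > 0" using elim x by (simp add: y_def)
  have my: "of_nat m * of_real x = complex_of_real y" by (simp add: y_def)
  have "Digamma (of_nat m * of_real x) - of_real (ln (real m * x)) = complex_of_real (Digamma y - ln y)"
    unfolding my using y by (simp add: Polygamma_of_real y_def[symmetric])
  then have "norm (Digamma (of_nat m * of_real x) - of_real (ln (real m * x)) :: complex) \<le> 1 / y"
    using Digamma_real_asymp[OF y] by (simp only: norm_of_real)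
  also have "1 / y = 1 / x * norm (cpowr (- 1) m)"
    using elim unfolding norm_of_real by (simp add: y_def powr_minus divide_inverse)
  finally show ?case .
qed

lemma Polygamma_plus1_bigo:
  assumes x: "x > 0" and k: "k \<ge> 1"
  shows "(\<lambda>m. Polygamma k (of_nat m * of_real x + 1)) \<in> O(cpowr (- real k))"
proof -
  let ?y = "\<lambda>m. of_nat m * of_real x :: complex"
  have "(\<lambda>m. (Polygamma k (?y m) + (-1) ^ k * fact (k - 1) / ?y m ^ k)
      - (-1) ^ k * fact (k - 1) * (1 / ?y m ^ k) + (-1) ^ k * fact k * (1 / ?y m ^ Suc k)) \<in> O(cpowr (- real k))"
    by (intro sum_in_bigo bigo_cpowr_cmult bigo_cpowr_power_divide
          bigo_cpowr_mono[OF Polygamma_bigo[OF x k]] bigo_cpowr_mono[OF bigo_cpowr_power_divide[of x "Suc k"]])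
       (use x in auto)
  moreover have "\<forall>\<^sub>F m in sequentially. (Polygamma k (?y m) + (-1) ^ k * fact (k - 1) / ?y m ^ k)
      - (-1) ^ k * fact (k - 1) * (1 / ?y m ^ k) + (-1) ^ k * fact k * (1 / ?y m ^ Suc k) = Polygamma k (?y m + 1)"
    using eventually_ge_at_top[of 1] by eventually_elim (use x in \<open>auto simp: Polygamma_plus1\<close>)
  ultimately show ?thesis by (rule bigo_cong_imp)
qed

text \<open>The logarithm is absorbed into m^(1/2). For r = 2 the factor (m x)^-(t+1) of the digamma
  term then leaves exactly m^-(t + 1/2), the order required of all remainders.\<close>

lemma Digamma_plus1_bigo:
  assumes x: "x > 0"
  shows "(\<lambda>m. euler_mascheroni + Digamma (of_nat m * of_real x + 1)) \<in> O(cpowr (1 / 2))"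
proof -
  let ?y = "\<lambda>m. of_nat m * of_real x :: complex"
  have ln: "(\<lambda>m. of_real (ln (real m * x))) \<in> O(cpowr (1 / 2))"
  proof -
    have "(\<lambda>m. ln (real m * x)) \<in> O(\<lambda>m. real m powr (1 / 2))" using x by real_asymp
    then show ?thesis by (rule iffD2[OF landau_o.big.of_real_iff])
  qed
  have "(\<lambda>m. euler_mascheroni + ((Digamma (?y m) - of_real (ln (real m * x))) + of_real (ln (real m * x))
      + 1 / ?y m ^ 1)) \<in> O(cpowr (1 / 2))"
    by (intro sum_in_bigo ln bigo_cpowr_mono[OF Digamma_bigo[OF x]] bigo_cpowr_mono[OF bigo_cpowr_const]
          bigo_cpowr_mono[OF bigo_cpowr_power_divide]) (use x in auto)
  moreover have "\<forall>\<^sub>F m in sequentially. euler_mascheroni + ((Digamma (?y m) - of_real (ln (real m * x)))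
      + of_real (ln (real m * x)) + 1 / ?y m ^ 1) = euler_mascheroni + Digamma (?y m + 1)"
    using eventually_ge_at_top[of 1] by eventually_elim (use x in \<open>auto simp: Digamma_plus1\<close>)
  ultimately show ?thesis by (rule bigo_cong_imp)
qed

text \<open>The weight m^t / m is m^(-s) at s = 1 - t; it turns the bound into m^(-3/2).\<close>

lemma bigo_power_divide_summable:
  assumes "f \<in> O(cpowr (- (real t + 1 / 2)))"
  shows "(\<lambda>m. f m * of_nat m ^ t / of_nat m) summable_on {1..}"
proof -
  have "(\<lambda>m. f m * (1 / of_nat m powi (1 - int t))) \<in> O(cpowr (- (real t + 1 / 2) + - real_of_int (1 - int t)))"
    by (intro bigo_cpowr_mult bigo_cpowr_powi assms)
  moreover have "\<forall>\<^sub>F m in sequentially. f m * (1 / of_nat m powi (1 - int t)) = f m * of_nat m ^ t / of_nat m"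
    using eventually_ge_at_top[of 1] by eventually_elim (simp add: power_int_diff)
  ultimately have "(\<lambda>m. f m * of_nat m ^ t / of_nat m) \<in> O(cpowr (- (real t + 1 / 2) + - real_of_int (1 - int t)))"
    by (rule bigo_cong_imp)
  also have "- (real t + 1 / 2) + - real_of_int (1 - int t) = - (3 / 2)" by simp
  finally show ?thesis by (rule bigo_powr_summable) simp
qed

lemma binom_int: "binom (int a) (int b) = a choose b"
  by (simp add: binom_def)

lemma binom_of_nat: "t + i \<ge> 1 \<Longrightarrow> binom (int i + int t - 1) (int i) = (t + i - 1) choose i"
proof -
  assume "t + i \<ge> 1"
  then have "int i + int t - 1 = int (t + i - 1)" by (simp add: of_nat_diff)
  then show ?thesis by (simp only: binom_int)
qed

lemma binom_of_nat_pred: "r \<ge> 2 \<Longrightarrow> t \<ge> 1 \<Longrightarrow> binom (int r + int t - 2) (int t - 1) = (r + t - 2) choose (t - 1)"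
proof -
  assume "r \<ge> 2" "t \<ge> 1"
  then have "int r + int t - 2 = int (r + t - 2)" "int t - 1 = int (t - 1)" by (simp_all add: of_nat_diff)
  then show ?thesis by (simp only: binom_int)
qed

text \<open>All terms of the series are positive. For r \<ge> 2 this keeps the residue from
  vanishing, so that 1 - t is a genuine pole.\<close>

lemma zeta_of_nat_nonzero:
  assumes "k \<ge> 2"
  shows "zeta (of_nat k) \<noteq> 0"
proof -
  have "(\<lambda>n. Re (inverse (of_nat (Suc n)) ^ k)) sums Re (zeta (of_nat k))"
    by (rule sums_Re[OF zeta_of_nat_sums[OF assms]])
  also have "(\<lambda>n. Re (inverse (of_nat (Suc n)) ^ k)) = (\<lambda>n. inverse (real (Suc n)) ^ k)"
  proof
    fix n
    have "inverse (of_nat (Suc n)) ^ k = complex_of_real (inverse (real (Suc n)) ^ k)" by simp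
    then show "Re (inverse (of_nat (Suc n)) ^ k) = inverse (real (Suc n)) ^ k" by (simp only: Re_complex_of_real)
  qed
  finally have s: "(\<lambda>n. inverse (real (Suc n)) ^ k) sums Re (zeta (of_nat k))" .
  have "0 < (\<Sum>n. inverse (real (Suc n)) ^ k)"
    by (rule suminf_pos[OF sums_summable[OF s]]) simp
  with s have "Re (zeta (of_nat k)) > 0" by (simp add: sums_iff)
  then show ?thesis by auto
qed

lemma infsum_eq_of_sums:
  fixes f :: "nat \<Rightarrow> complex"
  assumes "f summable_on {1..}" "(\<lambda>n. f (Suc n)) sums S"
  shows "infsum f {1..} = S"
  using summable_on_atLeast_1_sums[OF assms(1)] assms(2) by (rule sums_unique2)

lemma mult_of_real_not_nonpos_Int:
  assumes "x > 0" "m \<ge> 1"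
  shows "of_nat m * of_real x \<notin> (\<int>\<^sub>\<le>\<^sub>0 :: complex set)"
proof
  assume "of_nat m * of_real x \<in> (\<int>\<^sub>\<le>\<^sub>0 :: complex set)"
  then obtain k where "of_nat m * of_real x = (- of_nat k :: complex)"
    by (auto elim: nonpos_Ints_cases')
  then have "Re (of_nat m * of_real x) = Re (- of_nat k)" by simp
  then have "real m * x = - real k" by simp
  moreover have "real m * x > 0" using assms by simp
  ultimately show False by linarith
qed

section \<open>Inner sums for r \<ge> 2\<close>

definition MT_remainder :: "nat \<Rightarrow> nat \<Rightarrow> complex \<Rightarrow> complex" where
  "MT_remainder r t y =
     (\<Sum>i=1..r-2. (-1) ^ i * of_nat (binom (int i + int t - 1) (int i)) / y ^ (t + i) * zeta (of_nat (r - i)))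
     + (-1) ^ r * (\<Sum>j | j + 2 \<le> t. of_nat (binom (int j + int r - 1) (int j))
          * ((-1) ^ (t - j) / fact (t - j - 1)) / y ^ (r + j) * Polygamma (t - j - 1) (y + 1))
     - (-1) ^ r * of_nat (binom (int r + int t - 2) (int t - 1)) / y ^ (r + t - 1)
         * (euler_mascheroni + Digamma (y + 1))"

lemma add_2_le_set_eq: "{j :: nat. j + 2 \<le> t} = {..<t - 1}"
  by auto

text \<open>\<open>MT_remainder\<close> is the partial fraction formula without its term i = 0. The
  case t = 0 lies outside that formula: there the inner sum is \<zeta>(r) itself, and the remainder
  vanishes because \<open>binom\<close> is 0 at (i-1, i) for i \<ge> 1 and at (r-2, -1), while the
  sum over j is empty.\<close>

lemma MT_inner_eq:
  assumes x: "x > 0" and r: "r \<ge> 2" and m: "m \<ge> 1"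
  shows "MT_inner x r t m = zeta (of_nat r) / (of_nat m * of_real x) ^ t + MT_remainder r t (of_nat m * of_real x)"
proof (cases "t = 0")
  case True
  have "(\<lambda>n. inverse (of_nat (Suc n)) ^ r) sums MT_inner x r t m"
    using MT_inner_sums[OF x, of r t m] r True by (simp add: power_inverse divide_inverse)
  then have "MT_inner x r t m = zeta (of_nat r)"
    using zeta_of_nat_sums[OF r] sums_unique2 by blast
  moreover have "MT_remainder r t (of_nat m * of_real x) = 0"
    using True r by (auto simp: MT_remainder_def binom_def intro!: sum.neutral)
  ultimately show ?thesis using True by simp
next
  case False
  define y where "y = of_nat m * complex_of_real x"
  have y: "y \<notin> \<int>\<^sub>\<le>\<^sub>0" unfolding y_def by (rule mult_of_real_not_nonpos_Int[OF x m])
  obtain r' where r': "r = Suc (Suc r')" using r by (metis add_2_eq_Suc le_Suc_ex)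
  have "MT_inner x r t m =
     (\<Sum>i<r - 1. (-1) ^ i * of_nat ((t + i - 1) choose i) / y ^ (t + i) * zeta (of_nat (r - i)))
      + (-1) ^ r * (\<Sum>j<t - 1. of_nat ((r + j - 1) choose j) * ((-1) ^ (t - j) / fact (t - j - 1))
            / y ^ (r + j) * Polygamma (t - j - 1) (y + 1))
      - (-1) ^ r * of_nat ((r + t - 2) choose (t - 1)) / y ^ (r + t - 1) * (euler_mascheroni + Digamma (y + 1))"
    using MT_inner_sum[OF y, of r t] r False
    by (intro sums_unique2[OF MT_inner_sums[OF x, of r t m, folded y_def]]) auto
  also have "(\<Sum>i<r - 1. (-1) ^ i * of_nat ((t + i - 1) choose i) / y ^ (t + i) * zeta (of_nat (r - i))) =
     zeta (of_nat r) / y ^ t +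
     (\<Sum>i=1..r-2. (-1) ^ i * of_nat ((t + i - 1) choose i) / y ^ (t + i) * zeta (of_nat (r - i)))"
  proof -
    have "(\<Sum>i<r - 1. f i) = f 0 + (\<Sum>i=1..r-2. f i)" for f :: "nat \<Rightarrow> complex"
      by (simp add: r' sum.lessThan_Suc_shift sum.atLeast1_atMost_eq del: sum.lessThan_Suc)
    from this[of "\<lambda>i. (-1) ^ i * of_nat ((t + i - 1) choose i) / y ^ (t + i) * zeta (of_nat (r - i))"]
    show ?thesis by simp
  qed
  also have "(\<Sum>i=1..r-2. (-1) ^ i * of_nat ((t + i - 1) choose i) / y ^ (t + i) * zeta (of_nat (r - i))) =
     (\<Sum>i=1..r-2. (-1) ^ i * of_nat (binom (int i + int t - 1) (int i)) / y ^ (t + i) * zeta (of_nat (r - i)))"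
    by (rule sum.cong) (auto simp: binom_of_nat)
  also have "(\<Sum>j<t - 1. of_nat ((r + j - 1) choose j) * ((-1) ^ (t - j) / fact (t - j - 1))
            / y ^ (r + j) * Polygamma (t - j - 1) (y + 1)) =
      (\<Sum>j | j + 2 \<le> t. of_nat (binom (int j + int r - 1) (int j)) * ((-1) ^ (t - j) / fact (t - j - 1))
            / y ^ (r + j) * Polygamma (t - j - 1) (y + 1))"
    unfolding add_2_le_set_eq by (rule sum.cong) (use r in \<open>auto simp: binom_of_nat\<close>)
  also have "(r + t - 2) choose (t - 1) = binom (int r + int t - 2) (int t - 1)"
    using binom_of_nat_pred[OF r, of t] False by simp
  finally show ?thesis unfolding MT_remainder_def y_def[symmetric] by (simp only: add.assoc add_diff_eq)
qed

lemma psi_term_bigo: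
  assumes "x > 0" "j + 2 \<le> t"
  shows "psi_term x r t j \<in> O(cpowr (- real r))"
proof -
  have "psi_term x r t j = (\<lambda>m. Polygamma (t - j - 1) (of_nat m * of_real x + 1)
      * (1 / of_nat m powi (int r + int j - int t + 1)))"
    by (rule ext) (simp add: psi_term_def)
  also have "\<dots> \<in> O(cpowr (- real (t - j - 1) + - real_of_int (int r + int j - int t + 1)))"
    by (intro bigo_cpowr_mult bigo_cpowr_powi Polygamma_plus1_bigo) (use assms in auto)
  also have "- real (t - j - 1) + - real_of_int (int r + int j - int t + 1) = - real r"
    using assms(2) by (simp add: of_nat_diff)
  finally show ?thesis .
qed

text \<open>The exponents of 1/m are t + i \<ge> t + 1 for the terms in i, (r + j) + (t - j - 1) = r
  + t - 1 \<ge> t + 1 for those in j, and r + t - 1 - 1/2 \<ge> t + 1/2 for the digamma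
  term.\<close>

lemma MT_remainder_bigo:
  assumes x: "x > 0" and r: "r \<ge> 2"
  shows "(\<lambda>m. MT_remainder r t (of_nat m * of_real x)) \<in> O(cpowr (- (real t + 1 / 2)))"
proof -
  let ?y = "\<lambda>m. of_nat m * of_real x :: complex"
  have x0: "x \<noteq> 0" using x by simp
  have eq: "(\<lambda>m. MT_remainder r t (?y m)) = (\<lambda>m.
     (\<Sum>i=1..r-2. ((-1) ^ i * of_nat (binom (int i + int t - 1) (int i)) * zeta (of_nat (r - i))) * (1 / ?y m ^ (t + i)))
     + (-1) ^ r * (\<Sum>j | j + 2 \<le> t. (of_nat (binom (int j + int r - 1) (int j))
          * ((-1) ^ (t - j) / fact (t - j - 1))) * (1 / ?y m ^ (r + j) * Polygamma (t - j - 1) (?y m + 1)))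
     - ((-1) ^ r * of_nat (binom (int r + int t - 2) (int t - 1))) * (1 / ?y m ^ (r + t - 1)
         * (euler_mascheroni + Digamma (?y m + 1))))"
    by (rule ext) (simp add: MT_remainder_def mult_ac)
  have 1: "(\<lambda>m. 1 / ?y m ^ (t + i)) \<in> O(cpowr (- (real t + 1 / 2)))" if "i \<ge> 1" for i
    by (rule bigo_cpowr_mono[OF bigo_cpowr_power_divide[OF x0]]) (use that in auto)
  have 2: "(\<lambda>m. 1 / ?y m ^ (r + j) * Polygamma (t - j - 1) (?y m + 1)) \<in> O(cpowr (- (real t + 1 / 2)))"
    if "j + 2 \<le> t" for j
    by (rule bigo_cpowr_mono[OF bigo_cpowr_mult[OF bigo_cpowr_power_divide[OF x0] Polygamma_plus1_bigo[OF x]]])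
       (use that r in \<open>auto simp: of_nat_diff\<close>)
  have 3: "(\<lambda>m. 1 / ?y m ^ (r + t - 1) * (euler_mascheroni + Digamma (?y m + 1))) \<in> O(cpowr (- (real t + 1 / 2)))"
    by (rule bigo_cpowr_mono[OF bigo_cpowr_mult[OF bigo_cpowr_power_divide[OF x0] Digamma_plus1_bigo[OF x]]])
       (use r in \<open>auto simp: of_nat_diff\<close>)
  show ?thesis unfolding eq
    by (intro sum_in_bigo big_sum_in_bigo bigo_cpowr_cmult 1 2 3) auto
qed

text \<open>The weight m^(t-1) turns (m x)^-(t+i) into a multiple of m^-(i+1), hence \<zeta>(i+1),
  and leaves m^-r in the digamma term. Every piece is summable on its own, which allows the series
  to be split.\<close>

lemma MT_remainder_infsum:
  assumes x: "x > 0" and r: "r \<ge> 2"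
  shows "j + 2 \<le> t \<Longrightarrow> psi_term x r t j summable_on {1..}"
    and "(\<lambda>m. (euler_mascheroni + Digamma (of_nat m * of_real x + 1)) / of_nat m ^ r :: complex) summable_on {1..}"
    and "(\<Sum>\<^sub>\<infinity>m\<in>{1..}. MT_remainder r t (of_nat m * of_real x) * of_nat m ^ t / of_nat m) =
       (-1) ^ r * (\<Sum>j | j + 2 \<le> t.
                of_nat (binom (int j + int r - 1) (int j)) * ((-1) ^ (t - j) / fact (t - j - 1))
                * (1 / of_real x ^ (j + r)) * (\<Sum>\<^sub>\<infinity>m\<in>{1..}. psi_term x r t j m))
            + (\<Sum>i = 1..r - 2.
                (-1) ^ i / of_real x ^ (t + i) * of_nat (binom (int i + int t - 1) (int i))
                * zeta (of_nat (i + 1)) * zeta (of_nat (r - i)))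
            - (-1) ^ r / of_real x ^ (r + t - 1)
                * of_nat (binom (int r + int t - 2) (int t - 1))
                * (\<Sum>\<^sub>\<infinity>m\<in>{1..}.
                    (euler_mascheroni + Digamma (of_nat m * of_real x + 1)) / of_nat m ^ r)"
proof -
  let ?D = "\<lambda>m. (euler_mascheroni + Digamma (of_nat m * of_real x + 1)) / of_nat m ^ r :: complex"
  show psi: "psi_term x r t j summable_on {1..}" if "j + 2 \<le> t" for j
    by (rule bigo_powr_summable[OF psi_term_bigo[OF x that]]) (use r in auto)
  have D': "?D = (\<lambda>m. (euler_mascheroni + Digamma (of_nat m * of_real x + 1)) * (1 / of_nat m powi int r))"
    by (rule ext) simp
  have "?D \<in> O(cpowr (1 / 2 + - real_of_int (int r)))"
    unfolding D' by (intro bigo_cpowr_mult Digamma_plus1_bigo[OF x] bigo_cpowr_powi)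
  also have "1 / 2 + - real_of_int (int r) = - (real r - 1 / 2)" by simp
  finally show D: "?D summable_on {1..}"
    by (rule bigo_powr_summable) (use r in auto)
  have x0: "complex_of_real x \<noteq> 0" using x by simp
  have pt: "MT_remainder r t (of_nat m * of_real x) * of_nat m ^ t / of_nat m =
      (-1) ^ r * (\<Sum>j | j + 2 \<le> t.
                of_nat (binom (int j + int r - 1) (int j)) * ((-1) ^ (t - j) / fact (t - j - 1))
                * (1 / of_real x ^ (j + r)) * psi_term x r t j m)
            + (\<Sum>i = 1..r - 2.
                (-1) ^ i / of_real x ^ (t + i) * of_nat (binom (int i + int t - 1) (int i))
                * inverse (of_nat m) ^ (i + 1) * zeta (of_nat (r - i)))
            - (-1) ^ r / of_real x ^ (r + t - 1)
                * of_nat (binom (int r + int t - 2) (int t - 1)) * ?D m" if m: "m \<ge> 1" for m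
  proof -
    define y where "y = of_nat m * complex_of_real x"
    define c where "c = of_nat m ^ t / (of_nat m :: complex)"
    have m0: "of_nat m \<noteq> (0 :: complex)" using m by simp
    have p1: "c / y ^ (t + i) = inverse (of_nat m) ^ (i + 1) / of_real x ^ (t + i)" for i
      using m0 x0 by (simp add: c_def y_def power_mult_distrib power_add field_simps)
    have p2: "c / y ^ (r + j) = 1 / of_real x ^ (j + r) / of_nat m powi (int r + int j - int t + 1)" for j
    proof -
      have "of_nat m powi (int r + int j - int t + 1) = (of_nat m ^ (r + j) * of_nat m / of_nat m ^ t :: complex)"
        using m0 by (simp add: power_int_add power_int_diff power_add)
      then show ?thesis using m0 x0 by (simp add: c_def y_def power_mult_distrib field_simps)
    qed
    have p3: "c / y ^ (r + t - 1) = 1 / of_real x ^ (r + t - 1) / of_nat m ^ r"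
    proof -
      obtain r' where "r = Suc r'" using r by (cases r) auto
      then show ?thesis using m0 x0 by (simp add: c_def y_def power_mult_distrib power_add field_simps)
    qed
    have "MT_remainder r t y * of_nat m ^ t / of_nat m = MT_remainder r t y * c" by (simp add: c_def)
    also have "\<dots> =
     (\<Sum>i=1..r-2. (-1) ^ i * of_nat (binom (int i + int t - 1) (int i)) * (c / y ^ (t + i)) * zeta (of_nat (r - i)))
     + (-1) ^ r * (\<Sum>j | j + 2 \<le> t. of_nat (binom (int j + int r - 1) (int j))
          * ((-1) ^ (t - j) / fact (t - j - 1)) * (c / y ^ (r + j)) * Polygamma (t - j - 1) (y + 1))
     - (-1) ^ r * of_nat (binom (int r + int t - 2) (int t - 1)) * (c / y ^ (r + t - 1))
         * (euler_mascheroni + Digamma (y + 1))"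
      unfolding MT_remainder_def left_diff_distrib distrib_right
      by (simp add: sum_distrib_right sum_distrib_left mult_ac)
    finally show ?thesis
      unfolding p1 p2 p3 psi_term_def y_def[symmetric] by (simp add: mult_ac)
  qed
  have sums: "(\<lambda>n. MT_remainder r t (of_nat (Suc n) * of_real x) * of_nat (Suc n) ^ t / of_nat (Suc n)) sums
     ((-1) ^ r * (\<Sum>j | j + 2 \<le> t.
                of_nat (binom (int j + int r - 1) (int j)) * ((-1) ^ (t - j) / fact (t - j - 1))
                * (1 / of_real x ^ (j + r)) * (\<Sum>\<^sub>\<infinity>m\<in>{1..}. psi_term x r t j m))
            + (\<Sum>i = 1..r - 2.
                (-1) ^ i / of_real x ^ (t + i) * of_nat (binom (int i + int t - 1) (int i))
                * zeta (of_nat (i + 1)) * zeta (of_nat (r - i)))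
            - (-1) ^ r / of_real x ^ (r + t - 1)
                * of_nat (binom (int r + int t - 2) (int t - 1)) * (\<Sum>\<^sub>\<infinity>m\<in>{1..}. ?D m))"
    by (subst pt, simp, intro sums_add sums_diff sums_mult sums_mult2 sums_sum summable_on_atLeast_1_sums[OF D]
          summable_on_atLeast_1_sums[OF psi] zeta_of_nat_sums) auto
  have "(\<lambda>m. MT_remainder r t (of_nat m * of_real x) * of_nat m ^ t / of_nat m) summable_on {1..}"
    by (rule bigo_power_divide_summable[OF MT_remainder_bigo[OF x r]])
  from infsum_eq_of_sums[OF this sums]
  show "(\<Sum>\<^sub>\<infinity>m\<in>{1..}. MT_remainder r t (of_nat m * of_real x) * of_nat m ^ t / of_nat m) =
       (-1) ^ r * (\<Sum>j | j + 2 \<le> t.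
                of_nat (binom (int j + int r - 1) (int j)) * ((-1) ^ (t - j) / fact (t - j - 1))
                * (1 / of_real x ^ (j + r)) * (\<Sum>\<^sub>\<infinity>m\<in>{1..}. psi_term x r t j m))
            + (\<Sum>i = 1..r - 2.
                (-1) ^ i / of_real x ^ (t + i) * of_nat (binom (int i + int t - 1) (int i))
                * zeta (of_nat (i + 1)) * zeta (of_nat (r - i)))
            - (-1) ^ r / of_real x ^ (r + t - 1)
                * of_nat (binom (int r + int t - 2) (int t - 1)) * (\<Sum>\<^sub>\<infinity>m\<in>{1..}. ?D m)" .
qed

section \<open>Inner sums for r = 1\<close>

definition MT_remainder1 :: "real \<Rightarrow> nat \<Rightarrow> nat \<Rightarrow> complex" where
  "MT_remainder1 x t m =
     of_nat t / (of_nat m * of_real x) ^ (t + 1)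
     + (Digamma (of_nat m * of_real x) - of_real (ln (real m * x))) / (of_nat m * of_real x) ^ t
     - (\<Sum>j | j + 2 \<le> t. (-1) ^ (t - j) / fact (t - j - 1) / (of_nat m * of_real x) ^ (j + 1)
          * (Polygamma (t - j - 1) (of_nat m * of_real x)
              + (-1) ^ (t - j - 1) * fact (t - j - 2) / (of_nat m * of_real x) ^ (t - j - 1)))"

text \<open>With y = m x, every term of the partial fraction formula now has order y^-t, up to a
  logarithm. Two corrections make the remainder small. Shifting the arguments from y + 1 to y gives
  1/y^(t+1) for each of the t - 1 polygamma terms and for the digamma term, together t/y^(t+1).
  Removing the leading terms of the polygamma functions gives \<open>- harm (t - 1)\<close> over
  y^t.\<close>

lemma MT_inner_1_eq:
  assumes x: "x > 0" and t: "t \<ge> 1" and m: "m \<ge> 1"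
  shows "MT_inner x 1 t m =
    (euler_mascheroni + of_real (ln x) - harm (t - 1) + of_real (ln (real m))) / (of_nat m * of_real x) ^ t
     + MT_remainder1 x t m"
proof -
  define y where "y = of_nat m * complex_of_real x"
  have y: "y \<notin> \<int>\<^sub>\<le>\<^sub>0" unfolding y_def by (rule mult_of_real_not_nonpos_Int[OF x m])
  then have y0: "y \<noteq> 0" by auto
  define R where "R = (\<lambda>j. Polygamma (t - j - 1) y + (-1) ^ (t - j - 1) * fact (t - j - 2) / y ^ (t - j - 1))"
  have "MT_inner x 1 t m =
      (-1) ^ 1 * (\<Sum>j<t - 1. of_nat ((1 + j - 1) choose j) * ((-1) ^ (t - j) / fact (t - j - 1))
            / y ^ (1 + j) * Polygamma (t - j - 1) (y + 1))
      - (-1) ^ 1 * of_nat ((1 + t - 2) choose (t - 1)) / y ^ (1 + t - 1) * (euler_mascheroni + Digamma (y + 1))"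
    using MT_inner_sum[OF y, of 1 t] t
    by (intro sums_unique2[OF MT_inner_sums[OF x, of 1 t m, folded y_def]]) auto
  also have "\<dots> = (euler_mascheroni + Digamma (y + 1)) / y ^ t
      - (\<Sum>j<t - 1. (-1) ^ (t - j) / fact (t - j - 1) / y ^ (j + 1) * Polygamma (t - j - 1) (y + 1))"
    by simp
  also have "(\<Sum>j<t - 1. (-1) ^ (t - j) / fact (t - j - 1) / y ^ (j + 1) * Polygamma (t - j - 1) (y + 1)) =
     (\<Sum>j<t - 1. (-1) ^ (t - j) / fact (t - j - 1) / y ^ (j + 1) * R j
         + inverse (of_nat (Suc (t - 1 - Suc j))) / y ^ t - 1 / y ^ (t + 1))"
  proof (rule sum.cong[OF refl])
    fix j assume "j \<in> {..<t - 1}"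
    \<comment> \<open>With k = t - j - 2 the leading term of \<open>Polygamma (Suc k)\<close>
      contributes 1/((k+1) y^t), and k runs through 0, ..., t - 2.\<close>
    then obtain k where tk: "t = j + Suc (Suc k)" by (intro that[of "t - j - 2"]) auto
    have P: "Polygamma (Suc k) (y + 1) = R j - (-1) ^ Suc k * fact k / y ^ Suc k
        + (-1) ^ Suc k * fact (Suc k) / y ^ Suc (Suc k)"
      using Polygamma_plus1[OF y0, of "Suc k"] by (simp add: R_def tk)
    have sq: "(-1) ^ k * (-1) ^ k = (1 :: complex)" by (simp flip: power_mult_distrib)
    have "(-1) ^ Suc (Suc k) / fact (Suc k) / y ^ (j + 1) *
          (R j - (-1) ^ Suc k * fact k / y ^ Suc k + (-1) ^ Suc k * fact (Suc k) / y ^ Suc (Suc k)) =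
        (-1) ^ Suc (Suc k) / fact (Suc k) / y ^ (j + 1) * R j
        + ((-1) ^ k * (-1) ^ k) * (fact k / fact (Suc k)) / (y ^ (j + 1) * y ^ Suc k)
        - ((-1) ^ k * (-1) ^ k) * (fact (Suc k) / fact (Suc k)) / (y ^ (j + 1) * y ^ Suc (Suc k))"
      by (simp add: distrib_left right_diff_distrib mult_ac del: fact_Suc)
    also have "y ^ (j + 1) * y ^ Suc k = y ^ t" by (simp add: tk power_add)
    also have "y ^ (j + 1) * y ^ Suc (Suc k) = y ^ (t + 1)" by (simp add: tk power_add)
    also have "fact k / fact (Suc k) = (inverse (of_nat (Suc k)) :: complex)"
      by (simp add: divide_inverse)
    also have "fact (Suc k) / fact (Suc k) = (1 :: complex)" by (rule divide_self) (rule fact_nonzero)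
    finally show "(-1) ^ (t - j) / fact (t - j - 1) / y ^ (j + 1) * Polygamma (t - j - 1) (y + 1) =
       (-1) ^ (t - j) / fact (t - j - 1) / y ^ (j + 1) * R j
         + inverse (of_nat (Suc (t - 1 - Suc j))) / y ^ t - 1 / y ^ (t + 1)"
      using P sq by (simp add: tk del: fact_Suc power_Suc of_nat_Suc)
  qed
  also have "\<dots> = (\<Sum>j<t - 1. (-1) ^ (t - j) / fact (t - j - 1) / y ^ (j + 1) * R j)
      + harm (t - 1) / y ^ t - of_nat (t - 1) / y ^ (t + 1)"
    \<comment> \<open>\<open>Suc (t - 1 - Suc j)\<close> is t - 1 - j; reversing the order of
      summation turns the reciprocals into the harmonic number.\<close>
    unfolding harm_altdef
    by (subst sum.nat_diff_reindex[symmetric])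
       (simp add: sum.distrib sum_subtractf sum_divide_distrib del: of_nat_Suc)
  also have "Digamma (y + 1) = (Digamma y - of_real (ln (real m * x))) + of_real (ln x) + of_real (ln (real m)) + 1 / y"
    using Digamma_plus1[OF y0] x m by (simp add: ln_mult)
  also have "of_nat (t - 1) = (of_nat t - 1 :: complex)" using t by (simp add: of_nat_diff)
  finally have "MT_inner x 1 t m = (euler_mascheroni + ((Digamma y - of_real (ln (real m * x))) + of_real (ln x)
      + of_real (ln (real m)) + 1 / y)) / y ^ t
      - ((\<Sum>j<t - 1. (-1) ^ (t - j) / fact (t - j - 1) / y ^ (j + 1) * R j)
      + harm (t - 1) / y ^ t - (of_nat t - 1) / y ^ (t + 1))" .
  moreover have "1 / y / y ^ t = 1 / y ^ (t + 1)" by simp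
  ultimately show ?thesis
    unfolding MT_remainder1_def add_2_le_set_eq y_def[symmetric] R_def
    by (simp add: add_divide_distrib diff_divide_distrib)
qed

lemma psi_term1_bigo:
  assumes "x > 0" "j + 2 \<le> t"
  shows "psi_term1 x t j \<in> O(cpowr (- 2))"
proof -
  have k: "t - j - 2 = (t - j - 1) - 1" by simp
  have "psi_term1 x t j = (\<lambda>m. (Polygamma (t - j - 1) (of_nat m * of_real x)
        + (-1) ^ (t - j - 1) * fact ((t - j - 1) - 1) / (of_nat m * of_real x) ^ (t - j - 1))
      * (1 / of_nat m powi (int j - int t + 2)))"
    unfolding k[symmetric] by (rule ext) (simp add: psi_term1_def)
  also have "\<dots> \<in> O(cpowr (- real (t - j - 1 + 1) + - real_of_int (int j - int t + 2)))"
    by (intro bigo_cpowr_mult bigo_cpowr_powi Polygamma_bigo) (use assms in auto)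
  also have "- real (t - j - 1 + 1) + - real_of_int (int j - int t + 2) = - 2"
    using assms(2) by (simp add: of_nat_diff)
  finally show ?thesis .
qed

text \<open>Every part is O(m^-(t+1)), with no logarithm left: digamma minus logarithm gains a
  factor 1/m, and removing the leading term raises the exponent of a polygamma part to (j + 1) + (t
  - j).\<close>

lemma MT_remainder1_bigo:
  assumes x: "x > 0"
  shows "MT_remainder1 x t \<in> O(cpowr (- (real t + 1 / 2)))"
proof -
  let ?y = "\<lambda>m. of_nat m * of_real x :: complex"
  have x0: "x \<noteq> 0" using x by simp
  let ?R = "\<lambda>j m. Polygamma (t - j - 1) (?y m) + (-1) ^ (t - j - 1) * fact ((t - j - 1) - 1) / ?y m ^ (t - j - 1)"
  have eq: "MT_remainder1 x t = (\<lambda>m. of_nat t * (1 / ?y m ^ (t + 1))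
     + (Digamma (?y m) - of_real (ln (real m * x))) * (1 / ?y m ^ t)
     - (\<Sum>j | j + 2 \<le> t. ((-1) ^ (t - j) / fact (t - j - 1)) * (1 / ?y m ^ (j + 1) * ?R j m)))"
    by (rule ext) (simp add: MT_remainder1_def diff_diff_left numeral_2_eq_2)
  have 1: "(\<lambda>m. 1 / ?y m ^ (t + 1)) \<in> O(cpowr (- (real t + 1 / 2)))"
    by (rule bigo_cpowr_mono[OF bigo_cpowr_power_divide[OF x0]]) auto
  have 2: "(\<lambda>m. (Digamma (?y m) - of_real (ln (real m * x))) * (1 / ?y m ^ t)) \<in> O(cpowr (- (real t + 1 / 2)))"
    by (rule bigo_cpowr_mono[OF bigo_cpowr_mult[OF Digamma_bigo[OF x] bigo_cpowr_power_divide[OF x0]]]) auto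
  have 3: "(\<lambda>m. 1 / ?y m ^ (j + 1) * ?R j m) \<in> O(cpowr (- (real t + 1 / 2)))" if "j + 2 \<le> t" for j
    by (rule bigo_cpowr_mono[OF bigo_cpowr_mult[OF bigo_cpowr_power_divide[OF x0] Polygamma_bigo[OF x]]])
       (use that in \<open>auto simp: of_nat_diff\<close>)
  show ?thesis unfolding eq
    by (intro sum_in_bigo big_sum_in_bigo bigo_cpowr_cmult 1 2 3) auto
qed

text \<open>Multiplied by m^(t-1), the shift term t/(m x)^(t+1) becomes t m^-2 / x^(t+1), the source
  of \<zeta>(2); the corrected polygamma parts become multiples of \<open>psi_term1\<close>.\<close>

lemma MT_remainder1_infsum:
  assumes x: "x > 0"
  shows "j + 2 \<le> t \<Longrightarrow> psi_term1 x t j summable_on {1..}"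
    and "(\<lambda>m. (Digamma (of_nat m * of_real x) - of_real (ln (real m * x))) / of_nat m :: complex) summable_on {1..}"
    and "(\<Sum>\<^sub>\<infinity>m\<in>{1..}. MT_remainder1 x t m * of_nat m ^ t / of_nat m) =
       - (\<Sum>j | j + 2 \<le> t. (-1) ^ (t - j) / of_real x ^ (j + 1) / fact (t - j - 1)
                   * (\<Sum>\<^sub>\<infinity>m\<in>{1..}. psi_term1 x t j m))
              + of_nat t * zeta 2 / of_real x ^ (t + 1)
              + 1 / of_real x ^ t
                * (\<Sum>\<^sub>\<infinity>m\<in>{1..}. (Digamma (of_nat m * of_real x) - of_real (ln (real m * x))) / of_nat m)"
proof -
  let ?D = "\<lambda>m. (Digamma (of_nat m * of_real x) - of_real (ln (real m * x))) / of_nat m :: complex"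
  show psi: "psi_term1 x t j summable_on {1..}" if "j + 2 \<le> t" for j
    by (rule bigo_powr_summable[OF psi_term1_bigo[OF x that]]) auto
  have D': "?D = (\<lambda>m. (Digamma (of_nat m * of_real x) - of_real (ln (real m * x))) * (1 / of_nat m powi 1))"
    by (rule ext) simp
  have "?D \<in> O(cpowr (- 1 + - real_of_int 1))"
    unfolding D' by (intro bigo_cpowr_mult Digamma_bigo[OF x] bigo_cpowr_powi)
  also have "- 1 + - real_of_int 1 = - 2" by simp
  finally show D: "?D summable_on {1..}"
    by (rule bigo_powr_summable) auto
  have x0: "complex_of_real x \<noteq> 0" using x by simp
  have pt: "MT_remainder1 x t m * of_nat m ^ t / of_nat m =
      - (\<Sum>j | j + 2 \<le> t. (-1) ^ (t - j) / of_real x ^ (j + 1) / fact (t - j - 1) * psi_term1 x t j m)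
      + of_nat t * inverse (of_nat m) ^ 2 / of_real x ^ (t + 1) + 1 / of_real x ^ t * ?D m" if m: "m \<ge> 1" for m
  proof -
    define y where "y = of_nat m * complex_of_real x"
    define c where "c = of_nat m ^ t / (of_nat m :: complex)"
    have m0: "of_nat m \<noteq> (0 :: complex)" using m by simp
    have p1: "c / y ^ (t + 1) = inverse (of_nat m) ^ 2 / of_real x ^ (t + 1)"
      using m0 x0 by (simp add: c_def y_def power_mult_distrib power_add field_simps power2_eq_square)
    have p2: "c / y ^ (j + 1) = 1 / of_real x ^ (j + 1) / of_nat m powi (int j - int t + 2)" for j
    proof -
      have "of_nat m powi (int j - int t + 2) = (of_nat m ^ j * of_nat m ^ 2 / of_nat m ^ t :: complex)"
        using m0 by (simp add: power_int_add power_int_diff power_add)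
      then show ?thesis using m0 x0 by (simp add: c_def y_def power_mult_distrib field_simps power2_eq_square)
    qed
    have p3: "c / y ^ t = 1 / of_real x ^ t / of_nat m"
      using m0 x0 by (simp add: c_def y_def power_mult_distrib power_add field_simps)
    have "MT_remainder1 x t m * of_nat m ^ t / of_nat m = MT_remainder1 x t m * c" by (simp add: c_def)
    also have "\<dots> =
       of_nat t * (c / y ^ (t + 1)) + (Digamma y - of_real (ln (real m * x))) * (c / y ^ t)
       - (\<Sum>j | j + 2 \<le> t. (-1) ^ (t - j) / fact (t - j - 1) * (c / y ^ (j + 1))
          * (Polygamma (t - j - 1) y + (-1) ^ (t - j - 1) * fact (t - j - 2) / y ^ (t - j - 1)))"
      unfolding MT_remainder1_def left_diff_distrib distrib_right y_def[symmetric]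
      by (simp add: sum_distrib_right sum_distrib_left right_diff_distrib diff_divide_distrib mult_ac)
    finally show ?thesis
      unfolding p1 p2 p3 psi_term1_def y_def[symmetric]
      by (simp add: mult_ac power_divide inverse_eq_divide)
  qed
  have z2: "(\<lambda>n. inverse (of_nat (Suc n)) ^ 2) sums zeta 2"
    using zeta_of_nat_sums[of 2] by simp
  have sums: "(\<lambda>n. MT_remainder1 x t (Suc n) * of_nat (Suc n) ^ t / of_nat (Suc n)) sums
     (- (\<Sum>j | j + 2 \<le> t. (-1) ^ (t - j) / of_real x ^ (j + 1) / fact (t - j - 1)
                   * (\<Sum>\<^sub>\<infinity>m\<in>{1..}. psi_term1 x t j m))
              + of_nat t * zeta 2 / of_real x ^ (t + 1) + 1 / of_real x ^ t * (\<Sum>\<^sub>\<infinity>m\<in>{1..}. ?D m))"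
    by (subst pt, simp, intro sums_add sums_minus sums_divide sums_mult sums_sum z2
          summable_on_atLeast_1_sums[OF D] summable_on_atLeast_1_sums[OF psi]) auto
  show "(\<Sum>\<^sub>\<infinity>m\<in>{1..}. MT_remainder1 x t m * of_nat m ^ t / of_nat m) =
       - (\<Sum>j | j + 2 \<le> t. (-1) ^ (t - j) / of_real x ^ (j + 1) / fact (t - j - 1)
                   * (\<Sum>\<^sub>\<infinity>m\<in>{1..}. psi_term1 x t j m))
              + of_nat t * zeta 2 / of_real x ^ (t + 1) + 1 / of_real x ^ t * (\<Sum>\<^sub>\<infinity>m\<in>{1..}. ?D m)"
    by (rule infsum_eq_of_sums[OF bigo_power_divide_summable[OF MT_remainder1_bigo[OF x]] sums])
qed

theorem theorem3p4:
  fixes x :: real and \<Theta> :: "complex \<times> complex \<times> complex \<Rightarrow> complex"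
  assumes "x > 0" and "is_MT_zeta x \<Theta>"
  shows
   "(\<forall>r t :: nat. r \<ge> 2 \<longrightarrow>
       is_pole (\<lambda>s. \<Theta> (of_nat r, s, of_nat t)) (1 - of_nat t) \<and>
       (\<forall>j. j + 2 \<le> t \<longrightarrow> psi_term x r t j summable_on {1..}) \<and>
       (\<lambda>m. (euler_mascheroni + Digamma (of_nat m * of_real x + 1)) / of_nat m ^ r :: complex)
         summable_on {1..} \<and>
       (\<lambda>s. \<Theta> (of_nat r, s, of_nat t) -
          (zeta (of_nat r) / of_real x ^ t / (s - (1 - of_nat t)) +
           (euler_mascheroni * zeta (of_nat r) / of_real x ^ t
            + (-1) ^ r * (\<Sum>j | j + 2 \<le> t.
                of_nat (binom (int j + int r - 1) (int j)) * ((-1) ^ (t - j) / fact (t - j - 1))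
                * (1 / of_real x ^ (j + r)) * (\<Sum>\<^sub>\<infinity>m\<in>{1..}. psi_term x r t j m))
            + (\<Sum>i = 1..r - 2.
                (-1) ^ i / of_real x ^ (t + i) * of_nat (binom (int i + int t - 1) (int i))
                * zeta (of_nat (i + 1)) * zeta (of_nat (r - i)))
            - (-1) ^ r / of_real x ^ (r + t - 1)
                * of_nat (binom (int r + int t - 2) (int t - 1))
                * (\<Sum>\<^sub>\<infinity>m\<in>{1..}.
                    (euler_mascheroni + Digamma (of_nat m * of_real x + 1)) / of_nat m ^ r))))
         \<in> O[at (1 - of_nat t)](\<lambda>s. s - (1 - of_nat t))) \<and>
    (\<forall>t :: nat. t \<ge> 1 \<longrightarrow>
       is_pole (\<lambda>s. \<Theta> (1, s, of_nat t)) (1 - of_nat t) \<and>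
       (\<forall>j. j + 2 \<le> t \<longrightarrow> psi_term1 x t j summable_on {1..}) \<and>
       (\<lambda>m. (Digamma (of_nat m * of_real x) - of_real (ln (real m * x))) / of_nat m :: complex)
         summable_on {1..} \<and>
       (\<lambda>s. \<Theta> (1, s, of_nat t) -
          (1 / of_real x ^ t / (s - (1 - of_nat t)) ^ 2
           + 1 / of_real x ^ t / (s - (1 - of_nat t))
               * (euler_mascheroni + of_real (ln x) - harm (t - 1))
           + (1 / of_real x ^ t
                * (euler_mascheroni * (euler_mascheroni + of_real (ln x) - harm (t - 1))
                   + stieltjes1)
              - (\<Sum>j | j + 2 \<le> t.
                   (-1) ^ (t - j) / of_real x ^ (j + 1) / fact (t - j - 1)
                   * (\<Sum>\<^sub>\<infinity>m\<in>{1..}. psi_term1 x t j m))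
              + of_nat t * zeta 2 / of_real x ^ (t + 1)
              + 1 / of_real x ^ t
                * (\<Sum>\<^sub>\<infinity>m\<in>{1..}.
                    (Digamma (of_nat m * of_real x) - of_real (ln (real m * x))) / of_nat m))))
         \<in> O[at (1 - of_nat t)](\<lambda>s. s - (1 - of_nat t)))"
proof (intro conjI allI impI)
  have x: "x > 0" and mt: "is_MT_zeta x \<Theta>" by fact+
  have x0: "complex_of_real x \<noteq> 0" using x by simp
  {
    fix r t :: nat assume r: "r \<ge> 2"
    \<comment> \<open>Here A = \<zeta>(r)/x^t. The summand with factor 0 supplies B = 0, so the pole
      is simple and no Stieltjes constant occurs.\<close>
    have F: "MT_inner x r t m = (zeta (of_nat r) / of_real x ^ t + 0 * complex_of_real (ln (real m))) / of_nat m ^ t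
        + MT_remainder r t (of_nat m * of_real x)" if "m \<ge> 1" for m
      using MT_inner_eq[OF x r that, of t] by (simp add: power_mult_distrib mult.commute)
    have f: "(\<lambda>n. MT_inner x r t (Suc n) * of_nat (Suc n) powr - s) sums \<Theta> (of_nat r, s, of_nat t)"
      if "Re s > 2" for s
      using MT_slice(2)[OF x mt _ _ that, of r t] r by auto
    have hol: "(\<lambda>s. \<Theta> (of_nat r, s, of_nat t)) holomorphic_on {s. Re s > - real t} - {1 - of_nat t}"
      using MT_slice(1)[OF x mt, of r t] r by auto
    note sums = MT_remainder_infsum[OF x r]
    show "is_pole (\<lambda>s. \<Theta> (of_nat r, s, of_nat t)) (1 - of_nat t)"
      using Dirichlet_log_expansion(2)[OF hol f F MT_remainder_bigo[OF x r]] zeta_of_nat_nonzero[OF r] x0 by simp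
    show "psi_term x r t j summable_on {1..}" if "j + 2 \<le> t" for j
      by (rule sums(1)[OF that])
    show "(\<lambda>m. (euler_mascheroni + Digamma (of_nat m * of_real x + 1)) / of_nat m ^ r :: complex) summable_on {1..}"
      by (rule sums(2))
    show "(\<lambda>s. \<Theta> (of_nat r, s, of_nat t) -
          (zeta (of_nat r) / of_real x ^ t / (s - (1 - of_nat t)) +
           (euler_mascheroni * zeta (of_nat r) / of_real x ^ t
            + (-1) ^ r * (\<Sum>j | j + 2 \<le> t.
                of_nat (binom (int j + int r - 1) (int j)) * ((-1) ^ (t - j) / fact (t - j - 1))
                * (1 / of_real x ^ (j + r)) * (\<Sum>\<^sub>\<infinity>m\<in>{1..}. psi_term x r t j m))
            + (\<Sum>i = 1..r - 2.
                (-1) ^ i / of_real x ^ (t + i) * of_nat (binom (int i + int t - 1) (int i))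
                * zeta (of_nat (i + 1)) * zeta (of_nat (r - i)))
            - (-1) ^ r / of_real x ^ (r + t - 1)
                * of_nat (binom (int r + int t - 2) (int t - 1))
                * (\<Sum>\<^sub>\<infinity>m\<in>{1..}.
                    (euler_mascheroni + Digamma (of_nat m * of_real x + 1)) / of_nat m ^ r))))
         \<in> O[at (1 - of_nat t)](\<lambda>s. s - (1 - of_nat t))"
      using Dirichlet_log_expansion(1)[OF hol f F MT_remainder_bigo[OF x r]] unfolding sums(3)
      by (simp add: mult.commute[of "zeta (of_nat r)"] add_ac add_diff_eq)
  }
  {
    fix t :: nat assume t: "t \<ge> 1"
    \<comment> \<open>Here B = 1/x^t is nonzero, which gives the double pole. A = B (\<gamma> + ln x
      - H_(t-1)) is the coefficient of the simple pole, and A \<gamma> + B \<open>stieltjes1\<close>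
      is the first part of the constant.\<close>
    have F: "MT_inner x 1 t m = (1 / of_real x ^ t * (euler_mascheroni + of_real (ln x) - harm (t - 1))
        + 1 / of_real x ^ t * complex_of_real (ln (real m))) / of_nat m ^ t + MT_remainder1 x t m" if "m \<ge> 1" for m
      using MT_inner_1_eq[OF x t that]
      by (simp add: power_mult_distrib mult.commute add_divide_distrib diff_divide_distrib)
    have f: "(\<lambda>n. MT_inner x 1 t (Suc n) * of_nat (Suc n) powr - s) sums \<Theta> (1, s, of_nat t)"
      if "Re s > 2" for s
      using MT_slice(2)[OF x mt _ _ that, of 1 t] t by auto
    have hol: "(\<lambda>s. \<Theta> (1, s, of_nat t)) holomorphic_on {s. Re s > - real t} - {1 - of_nat t}"
      using MT_slice(1)[OF x mt, of 1 t] t by auto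
    note sums = MT_remainder1_infsum[OF x]
    show "is_pole (\<lambda>s. \<Theta> (1, s, of_nat t)) (1 - of_nat t)"
      by (rule Dirichlet_log_expansion(2)[OF hol f F MT_remainder1_bigo[OF x]]) (use x0 in auto)
    show "psi_term1 x t j summable_on {1..}" if "j + 2 \<le> t" for j
      by (rule sums(1)[OF that])
    show "(\<lambda>m. (Digamma (of_nat m * of_real x) - of_real (ln (real m * x))) / of_nat m :: complex) summable_on {1..}"
      by (rule sums(2))
    show "(\<lambda>s. \<Theta> (1, s, of_nat t) -
          (1 / of_real x ^ t / (s - (1 - of_nat t)) ^ 2
           + 1 / of_real x ^ t / (s - (1 - of_nat t))
               * (euler_mascheroni + of_real (ln x) - harm (t - 1))
           + (1 / of_real x ^ t
                * (euler_mascheroni * (euler_mascheroni + of_real (ln x) - harm (t - 1))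
                   + stieltjes1)
              - (\<Sum>j | j + 2 \<le> t.
                   (-1) ^ (t - j) / of_real x ^ (j + 1) / fact (t - j - 1)
                   * (\<Sum>\<^sub>\<infinity>m\<in>{1..}. psi_term1 x t j m))
              + of_nat t * zeta 2 / of_real x ^ (t + 1)
              + 1 / of_real x ^ t
                * (\<Sum>\<^sub>\<infinity>m\<in>{1..}.
                    (Digamma (of_nat m * of_real x) - of_real (ln (real m * x))) / of_nat m))))
         \<in> O[at (1 - of_nat t)](\<lambda>s. s - (1 - of_nat t))"
      using Dirichlet_log_expansion(1)[OF hol f F MT_remainder1_bigo[OF x]] unfolding sums(3)
      by (simp add: distrib_left add_ac add_diff_eq
            mult.commute[of "euler_mascheroni + of_real (ln x) - harm (t - Suc 0)"])
  }
qed

end
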